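(* Let $k\ge27$ be an integer, $\varepsilon_k=\frac{4\log k}{k}$, $X$ uniform over $[0,1)$, and assume that $s:[0,1)\to\mathbb{R}$ is twice differentiable and that $C_3>0$ satisfies $|s(t)-s(x)-s'(x)(t-x)-\frac12s''(x)(t-x)^2|\le C_3|t-x|^3$ for all $t,x\in[0,1)$. Write $\mathcal{B}(x)=\mathcal{B}_{\mathcal{U}_k^{\mathtt{purf}},\infty}(x)$. Then for every $x\in[\varepsilon_k,1-\varepsilon_k]$, $$\Big|\mathcal{B}(x)-\frac{(s''(x))^2}{4k^4}\Big|\le\frac{\big(3C_3+\frac1{27^2}|s'(x)|+2|s''(x)|\big)^2}{k^5},$$ and for every $x\in(0,1)\setminus[\varepsilon_k,1-\varepsilon_k]$, $$\Big|\mathcal{B}(x)-\frac{(s'(x))^2\big(x^{k+1}-(1-x)^{k+1}\big)^2}{4k^2}\Big|\le\frac{\big(C_3+|s'(x)|+|s''(x)|\big)^2}{2k^3}.$$ As a consequence, $$\Big|\int_0^1\mathcal{B}(x)dx-\frac{(s'(0))^2+(s'(1))^2}{8k^3}\Big|\le\frac{6\big(C_3+\|s'\|_\infty+\|s''\|_\infty\big)^2\log k}{k^4}$$ and $$\Big|\int_{\varepsilon_k}^{1-\varepsilon_k}\mathcal{B}(x)dx-\frac1{4k^4}\int_{\varepsilon_k}^{1-\varepsilon_k}(s''(x))^2dx\Big|\le\frac{\big(3C_3+\frac1{27^2}\|s'\|_\infty+2\|s''\|_\infty\big)^2}{k^5}.$$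
   Context: $\mathbb{U}\sim\mathcal{U}_k^{\mathtt{purf}}$ means $\mathbb{U}=\{[0,\xi_{(1)}),[\xi_{(1)},\xi_{(2)}),\dots,[\xi_{(k)},1)\}$, where $\xi_{(1)}<\dots<\xi_{(k)}$ are the order statistics of $k$ independent random variables uniform over $[0,1)$. For a partition $\mathbb{U}$ of $[0,1)$ into intervals, $I_{\mathbb{U}}(x)$ is the cell containing $x$ and $\tilde s_{\mathbb{U}}(x)=\mathbb{E}[s(X)\mid X\in I_{\mathbb{U}}(x)]=\frac1{|I_{\mathbb{U}}(x)|}\int_{I_{\mathbb{U}}(x)}s(t)dt$. For a distribution $\mathcal{U}$ on partitions, $\mathcal{B}_{\mathcal{U},\infty}(x)=(s(x)-\mathbb{E}_{\mathbb{U}\sim\mathcal{U}}[\tilde s_{\mathbb{U}}(x)])^2$. $\|\cdot\|_\infty$ is the sup-norm on $[0,1)$, and $s'(1)$ denotes $\lim_{x\to1^-}s'(x)$. *)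

theory Defs
  imports "HOL-Probability.Probability"
begin

definition unif01 :: "real measure" where
  "unif01 = uniform_measure lborel {0..<1}"

text \<open>Break points are \<open>0\<close>, the order statistics of \<open>\<xi> 0, \<dots>, \<xi> (k - 1)\<close>, and \<open>1\<close>.
  Ties (a null event below) only produce empty cells.\<close>

definition purf_partition :: "nat \<Rightarrow> (nat \<Rightarrow> real) \<Rightarrow> real set set" where
  "purf_partition k \<xi> =
    (let b = 0 # sort (map \<xi> [0..<k]) @ [1] in {{b ! i..<b ! Suc i} | i. i \<le> k})"

text \<open>The law of the random partition generated by \<open>k\<close> independent uniform variables. The
  \<open>\<sigma>\<close>-algebra on partitions is the largest one that makes the partition map measurable, so
  a function of the partition is measurable iff its composition with that map is.\<close>

definition purf :: "nat \<Rightarrow> real set set measure" where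
  "purf k =
    (let P = Pi\<^sub>M {..<k} (\<lambda>_. unif01)
     in distr P (sigma UNIV {A. purf_partition k -` A \<inter> space P \<in> sets P}) (purf_partition k))"

definition partition_cell :: "real set set \<Rightarrow> real \<Rightarrow> real set" where
  "partition_cell U x = (THE I. I \<in> U \<and> x \<in> I)"

definition cell_average :: "(real \<Rightarrow> real) \<Rightarrow> real set set \<Rightarrow> real \<Rightarrow> real" where
  "cell_average s U x =
    1 / measure lborel (partition_cell U x) * (LINT t:partition_cell U x|lborel. s t)"

definition bias_inf :: "real set set measure \<Rightarrow> (real \<Rightarrow> real) \<Rightarrow> real \<Rightarrow> real" where
  "bias_inf \<U> s x = (s x - (LINT U|\<U>. cell_average s U x))\<^sup>2"

definition sup_norm01 :: "(real \<Rightarrow> real) \<Rightarrow> real" where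
  "sup_norm01 f = (SUP x\<in>{0..<1}. \<bar>f x\<bar>)"

lemma prob_space_unif01: "prob_space unif01"
  unfolding unif01_def by (rule prob_space_uniform_measure) auto

lemma measurable_purf_partition:
  "purf_partition k \<in> Pi\<^sub>M {..<k} (\<lambda>_. unif01) \<rightarrow>\<^sub>M
    sigma UNIV {A. purf_partition k -` A \<inter> space (Pi\<^sub>M {..<k} (\<lambda>_. unif01))
      \<in> sets (Pi\<^sub>M {..<k} (\<lambda>_. unif01))}"
  by (rule measurable_measure_of) auto

lemma prob_space_purf: "prob_space (purf k)"
proof -
  have "prob_space (Pi\<^sub>M {..<k} (\<lambda>_. unif01))"
    by (intro prob_space_PiM prob_space_unif01)
  then show ?thesis
    unfolding purf_def Let_def by (rule prob_space.prob_space_distr[OF _ measurable_purf_partition])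
qed

end

theory Submission
  imports Defs
begin

text \<open>
  Let \<open>D\<close> and \<open>U\<close> be the distances from \<open>x\<close> to the left and right end of its random cell, and
  \<open>\<Delta>\<close> the expected cell average minus \<open>s x\<close>, so that the bias is \<open>\<Delta>\<^sup>2\<close>. Averaging the Taylor expansion at
  \<open>x\<close> over the cell (\<open>average_Taylor\<close>) gives
  \<open>s' x * (U - D) / 2 + s'' x / 6 * (U\<^sup>2 - U * D + D\<^sup>2)\<close> up to an error \<open>C / 4 * (U ^ 3 + D ^ 3)\<close>.
  For \<open>0 \<le> u < 1 - x\<close> and \<open>0 \<le> d < x\<close>, the inequalities \<open>U > u\<close> and \<open>D > d\<close> together mean
  that none of the \<open>k\<close> points falls into \<open>[x - d, x + u]\<close>; this event has probability
  \<open>(1 - u - d) ^ k\<close>, and all moments follow from the layer-cake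
  formula (\<open>expectation_gaps\<close>). With \<open>X = x ^ (k + 1)\<close> and \<open>Y = (1 - x) ^ (k + 1)\<close>, the mean of
  \<open>(U - D) / 2\<close> is \<open>(Y - X) / (2 * (k + 1))\<close>, the mean of \<open>(U\<^sup>2 - U * D + D\<^sup>2) / 3\<close> is at most
  \<open>1 / ((k + 1) * (k + 2))\<close> and differs from it by at most \<open>2 * (X + Y) / (3 * (k + 1))\<close>, and the third
  moments are at most \<open>6 / k ^ 3\<close> (\<open>expected_deviation\<close>).

  For \<open>x\<close> at distance at least \<open>\<epsilon> = 4 * ln k / k\<close> from \<open>0\<close> and \<open>1\<close> both \<open>X\<close> and \<open>Y\<close> are at most
  \<open>k powr -4\<close>; the first-order term is then negligible and \<open>\<Delta>\<close> is \<open>s'' x / (2 * k\<^sup>2)\<close> up to order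
  \<open>k powr -3\<close>. Near the boundary the first-order term \<open>s' x * (Y - X) / (2 * k)\<close> dominates, with an
  error of order \<open>k powr -2\<close>. In both cases \<open>\<Delta>\<^sup>2 - q\<^sup>2 = (\<Delta> - q) * (\<Delta> + q)\<close>, with \<open>q\<close> the main term,
  gives the pointwise claims. The second pointwise estimate in fact holds on all of \<open>(0, 1)\<close>.

  For the integral over \<open>[0, 1)\<close>, the two boundary layers of width \<open>\<epsilon>\<close> carry the main term: \<open>(Y - X)\<^sup>2\<close> integrates
  to about \<open>1 / (2 * k)\<close> on each, and \<open>s'\<close> may be frozen at the endpoint because it is Lipschitz. The
  pointwise error times the width of the layers produces the logarithm; the interior contributes
  only \<open>O(k powr -4)\<close>. The Taylor hypothesis itself forces \<open>s'\<close> and \<open>s''\<close> to be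
  bounded (\<open>derivatives_bounded\<close>), so the sup-norms are genuine suprema and \<open>s'\<close> has a limit at \<open>1\<close>.
\<close>

section \<open>The cell containing a point\<close>

text \<open>The endpoints of the cell containing \<open>x\<close>: the last break point \<open>\<le> x\<close> and the first one \<open>> x\<close>.
  They are defined for every \<open>\<xi>\<close>, also when some \<open>\<xi> i\<close> lies outside \<open>[0, 1)\<close>; the
  default values \<open>0\<close> and \<open>1\<close> are used only if no \<open>\<xi> i\<close> lies on that side of \<open>x\<close>.\<close>

definition left_end :: "nat \<Rightarrow> (nat \<Rightarrow> real) \<Rightarrow> real \<Rightarrow> real" where
  "left_end k \<xi> x = (if \<exists>i<k. \<xi> i \<le> x then Max (\<xi> ` {i. i < k \<and> \<xi> i \<le> x}) else 0)"

definition right_end :: "nat \<Rightarrow> (nat \<Rightarrow> real) \<Rightarrow> real \<Rightarrow> real" where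
  "right_end k \<xi> x = (if \<exists>i<k. x < \<xi> i then Min (\<xi> ` {i. i < k \<and> x < \<xi> i}) else 1)"

lemma left_end_ge_iff:
  "c \<le> left_end k \<xi> x \<longleftrightarrow> (\<exists>i<k. \<xi> i \<le> x \<and> c \<le> \<xi> i) \<or> ((\<forall>i<k. x < \<xi> i) \<and> c \<le> 0)"
proof (cases "\<exists>i<k. \<xi> i \<le> x")
  case True
  then have "c \<le> left_end k \<xi> x \<longleftrightarrow> (\<exists>y\<in>\<xi> ` {i. i < k \<and> \<xi> i \<le> x}. c \<le> y)"
    by (subst left_end_def) (simp add: Max_ge_iff)
  moreover have "\<not> (\<forall>i<k. x < \<xi> i)" using True by (simp add: not_less)
  ultimately show ?thesis by blast
next
  case False
  then have "left_end k \<xi> x = 0" unfolding left_end_def by (rule if_not_P)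
  with False show ?thesis by (metis not_le)
qed

lemma right_end_le_iff:
  "right_end k \<xi> x \<le> c \<longleftrightarrow> (\<exists>i<k. x < \<xi> i \<and> \<xi> i \<le> c) \<or> ((\<forall>i<k. \<xi> i \<le> x) \<and> 1 \<le> c)"
proof (cases "\<exists>i<k. x < \<xi> i")
  case True
  then have "right_end k \<xi> x \<le> c \<longleftrightarrow> (\<exists>y\<in>\<xi> ` {i. i < k \<and> x < \<xi> i}. y \<le> c)"
    by (subst right_end_def) (simp add: Min_le_iff)
  moreover have "\<not> (\<forall>i<k. \<xi> i \<le> x)" using True by (simp add: not_le)
  ultimately show ?thesis by blast
next
  case False
  then have "right_end k \<xi> x = 1" unfolding right_end_def by (rule if_not_P)
  with False show ?thesis by (metis not_le)
qed

lemma left_end_le: "0 \<le> x \<Longrightarrow> left_end k \<xi> x \<le> x"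
  using left_end_ge_iff[of "left_end k \<xi> x" k \<xi> x] by auto

lemma right_end_gt: "x < 1 \<Longrightarrow> x < right_end k \<xi> x"
proof (cases "\<exists>i<k. x < \<xi> i")
  case True
  then have "{i. i < k \<and> x < \<xi> i} \<noteq> {}" by auto
  with True show ?thesis by (auto simp: right_end_def)
qed (auto simp: right_end_def)

lemma left_end_mem: "left_end k \<xi> x \<in> insert 0 (\<xi> ` {..<k})"
proof (cases "\<exists>i<k. \<xi> i \<le> x")
  case True
  then have "Max (\<xi> ` {i. i < k \<and> \<xi> i \<le> x}) \<in> \<xi> ` {i. i < k \<and> \<xi> i \<le> x}"
    by (intro Max_in) auto
  then have "Max (\<xi> ` {i. i < k \<and> \<xi> i \<le> x}) \<in> \<xi> ` {..<k}" by blast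
  with True show ?thesis by (simp add: left_end_def)
qed (auto simp: left_end_def)

lemma right_end_mem: "right_end k \<xi> x \<in> insert 1 (\<xi> ` {..<k})"
proof (cases "\<exists>i<k. x < \<xi> i")
  case True
  then have "Min (\<xi> ` {i. i < k \<and> x < \<xi> i}) \<in> \<xi> ` {i. i < k \<and> x < \<xi> i}"
    by (intro Min_in) auto
  then have "Min (\<xi> ` {i. i < k \<and> x < \<xi> i}) \<in> \<xi> ` {..<k}" by blast
  with True show ?thesis by (simp add: right_end_def)
qed (auto simp: right_end_def)

text \<open>This holds for all \<open>\<xi>\<close>, not only almost surely. The exact version is needed for the
  measurability of the cell average with respect to the uncompleted product \<open>\<sigma>\<close>-algebra.\<close>

lemma partition_cell_purf_partition:
  assumes "0 \<le> x" "x < 1"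
  shows "partition_cell (purf_partition k \<xi>) x = {left_end k \<xi> x..<right_end k \<xi> x}"
proof -
  define L where "L = sort (map \<xi> [0..<k])"
  define b where "b = 0 # L @ [1::real]"
  \<comment> \<open>\<open>j\<close> is the number of break points \<open>\<xi> i \<le> x\<close>, so the cell is the one with index \<open>j\<close>.\<close>
  define j where "j = length (takeWhile (\<lambda>y. y \<le> x) L)"
  have lenL: "length L = k" and setL: "set L = \<xi> ` {..<k}" and srt: "sorted L"
    by (auto simp: L_def atLeast0LessThan)
  have jk: "j \<le> k" unfolding j_def lenL[symmetric] by (rule length_takeWhile_le)
  have le: "L ! i \<le> x" if "i < j" for i
  proof -
    have "takeWhile (\<lambda>y. y \<le> x) L ! i \<in> set (takeWhile (\<lambda>y. y \<le> x) L)"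
      using that unfolding j_def by (rule nth_mem)
    then show ?thesis using that set_takeWhileD takeWhile_nth unfolding j_def by fastforce
  qed
  have gt: "x < L ! i" if "j \<le> i" "i < k" for i
  proof -
    have "\<not> L ! j \<le> x"
      using nth_length_takeWhile[of "\<lambda>y. y \<le> x" L] that by (auto simp: j_def lenL)
    moreover have "L ! j \<le> L ! i" using srt that by (auto intro: sorted_nth_mono simp: lenL)
    ultimately show ?thesis by simp
  qed
  have idx: "\<exists>m<k. \<xi> i = L ! m" if "i < k" for i
  proof -
    have "\<xi> i \<in> set L" using that setL by auto
    then show ?thesis by (metis in_set_conv_nth lenL)
  qed
  have idx': "\<exists>i<k. \<xi> i = L ! m" if "m < k" for m
  proof -
    have "L ! m \<in> set L" using that lenL by auto
    then show ?thesis unfolding setL by auto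
  qed
  have left: "left_end k \<xi> x = b ! j"
  proof (cases j)
    case 0
    then have "\<not> (\<exists>i<k. \<xi> i \<le> x)" using idx gt by (metis le0 not_le)
    then show ?thesis using 0 by (auto simp: left_end_def b_def)
  next
    case (Suc p)
    then have p: "p < k" "p < j" using jk by auto
    obtain i where i: "i < k" "\<xi> i = L ! p" using idx'[OF p(1)] by auto
    have "Max (\<xi> ` {i. i < k \<and> \<xi> i \<le> x}) = L ! p"
    proof (rule Max_eqI)
      fix y assume "y \<in> \<xi> ` {i. i < k \<and> \<xi> i \<le> x}"
      then obtain m where m: "m < k" "y = L ! m" "y \<le> x" using idx by blast
      then have "m < j" using gt[of m] by force
      then show "y \<le> L ! p" using m Suc srt p lenL by (auto intro!: sorted_nth_mono)
    next
      show "L ! p \<in> \<xi> ` {i. i < k \<and> \<xi> i \<le> x}" using i le[OF p(2)] by (auto intro!: image_eqI[of _ _ i])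
    qed simp
    moreover have "\<exists>i<k. \<xi> i \<le> x" using i le[OF p(2)] by auto
    ultimately show ?thesis using Suc p lenL by (auto simp: left_end_def b_def nth_append)
  qed
  have right: "right_end k \<xi> x = b ! Suc j"
  proof (cases "j = k")
    case True
    then have "\<not> (\<exists>i<k. x < \<xi> i)" using idx le by (metis not_le)
    then show ?thesis using True lenL by (auto simp: right_end_def b_def nth_append)
  next
    case False
    then have j: "j < k" using jk by auto
    obtain i where i: "i < k" "\<xi> i = L ! j" using idx'[OF j] by auto
    have "Min (\<xi> ` {i. i < k \<and> x < \<xi> i}) = L ! j"
    proof (rule Min_eqI)
      fix y assume "y \<in> \<xi> ` {i. i < k \<and> x < \<xi> i}"
      then obtain m where m: "m < k" "y = L ! m" "x < y" using idx by blast
      then have "j \<le> m" using le[of m] by force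
      then show "L ! j \<le> y" using m srt lenL by (auto intro!: sorted_nth_mono)
    next
      show "L ! j \<in> \<xi> ` {i. i < k \<and> x < \<xi> i}" using i gt[OF _ j] by (auto intro!: image_eqI[of _ _ i])
    qed simp
    moreover have "\<exists>i<k. x < \<xi> i" using i gt[OF _ j] by auto
    ultimately show ?thesis using j lenL by (auto simp: right_end_def b_def nth_append)
  qed
  have uniq: "i = j" if "i \<le> k" "b ! i \<le> x" "x < b ! Suc i" for i
  proof (rule ccontr)
    assume "i \<noteq> j"
    then consider "i < j" | "j < i" by linarith
    then show False
    proof cases
      case 1
      then have "b ! Suc i = L ! i" using jk lenL by (auto simp: b_def nth_append)
      then show False using le[OF 1] that by auto
    next
      case 2
      then obtain p where p: "i = Suc p" by (cases i) auto
      then have "b ! i = L ! p" using that lenL by (auto simp: b_def nth_append)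
      then show False using gt[of p] 2 p that by auto
    qed
  qed
  have P: "purf_partition k \<xi> = {{b ! i..<b ! Suc i} |i. i \<le> k}"
    by (simp add: purf_partition_def Let_def b_def L_def)
  have mem: "b ! j \<le> x" "x < b ! Suc j"
    using left_end_le[OF assms(1), of k \<xi>] right_end_gt[OF assms(2), of k \<xi>] left right by auto
  show ?thesis unfolding partition_cell_def left right
  proof (rule the_equality)
    show "{b ! j..<b ! Suc j} \<in> purf_partition k \<xi> \<and> x \<in> {b ! j..<b ! Suc j}"
      using mem jk P by auto
  next
    fix I assume "I \<in> purf_partition k \<xi> \<and> x \<in> I"
    then obtain i where "i \<le> k" "I = {b ! i..<b ! Suc i}" "x \<in> I" unfolding P by auto
    then show "I = {b ! j..<b ! Suc j}" using uniq[of i] by auto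
  qed
qed

lemma borel_measurable_left_end [measurable]:
  assumes [measurable]: "\<And>i. i < k \<Longrightarrow> (\<lambda>w. f w i) \<in> borel_measurable M" "g \<in> borel_measurable M"
  shows "(\<lambda>w. left_end k (f w) (g w)) \<in> borel_measurable M"
  unfolding borel_measurable_iff_ge
proof
  fix c :: real
  have "{w \<in> space M. c \<le> left_end k (f w) (g w)} =
    {w \<in> space M. (\<exists>i\<in>{..<k}. f w i \<le> g w \<and> c \<le> f w i) \<or> ((\<forall>i\<in>{..<k}. g w < f w i) \<and> c \<le> 0)}"
    by (auto simp: left_end_ge_iff)
  also have "\<dots> \<in> sets M" by measurable auto
  finally show "{w \<in> space M. c \<le> left_end k (f w) (g w)} \<in> sets M" .
qed

lemma borel_measurable_right_end [measurable]:
  assumes [measurable]: "\<And>i. i < k \<Longrightarrow> (\<lambda>w. f w i) \<in> borel_measurable M" "g \<in> borel_measurable M"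
  shows "(\<lambda>w. right_end k (f w) (g w)) \<in> borel_measurable M"
  unfolding borel_measurable_iff_le
proof
  fix c :: real
  have "{w \<in> space M. right_end k (f w) (g w) \<le> c} =
    {w \<in> space M. (\<exists>i\<in>{..<k}. g w < f w i \<and> f w i \<le> c) \<or> ((\<forall>i\<in>{..<k}. f w i \<le> g w) \<and> 1 \<le> c)}"
    by (auto simp: right_end_le_iff)
  also have "\<dots> \<in> sets M" by measurable auto
  finally show "{w \<in> space M. right_end k (f w) (g w) \<le> c} \<in> sets M" .
qed

text \<open>No measurability of \<open>s\<close> is assumed. Integrability on \<open>A r\<close> holds for \<open>r\<close> in an interval
  \<open>J\<close>; on \<open>J\<close> the integral is a difference of two monotone functions, and off \<open>J\<close> it is \<open>0\<close>
  by convention.\<close>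

lemma borel_measurable_set_integral_mono:
  fixes A :: "real \<Rightarrow> 'a set" and s :: "'a \<Rightarrow> real"
  assumes A: "mono A" and [measurable]: "\<And>r. A r \<in> sets M"
  shows "{r. set_integrable M (A r) s} \<in> sets borel"
    and "(\<lambda>r. LINT t:A r|M. s t) \<in> borel_measurable borel"
proof -
  define J where "J = {r. set_integrable M (A r) s}"
  have down: "set_integrable M (A r') s" if "set_integrable M (A r) s" "r' \<le> r" for r r'
    using that monoD[OF A] by (meson set_integrable_subset assms(2))
  show J[measurable]: "{r. set_integrable M (A r) s} \<in> sets borel"
    by (rule real_interval_borel_measurable)
       (auto simp: is_interval_def box_real dest: down)
  have pos: "set_integrable M (A r) (\<lambda>t. max 0 (c * s t))" if "r \<in> J" for r c
  proof -
    have "set_integrable M (A r) (\<lambda>t. c * s t)" using that by (auto simp: J_def)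
    then have "integrable M (\<lambda>t. max 0 (indicator (A r) t *\<^sub>R (c * s t)))"
      unfolding set_integrable_def by (intro integrable_max) auto
    then show ?thesis unfolding set_integrable_def
      by (rule back_subst[of "integrable M"]) (auto split: split_indicator)
  qed
  define G where "G c r = (LINT t:A r|M. max 0 (c * s t))" for c r
  have G: "mono_on J (G c)" for c
  proof (rule mono_onI)
    fix r r' assume r: "r \<in> J" "r' \<in> J" "r \<le> r'"
    show "G c r \<le> G c r'" unfolding G_def set_lebesgue_integral_def
      using pos[OF r(1), of c] pos[OF r(2), of c] monoD[OF A r(3)]
      unfolding set_integrable_def by (intro integral_mono) (auto split: split_indicator)
  qed
  have [measurable]: "(\<lambda>r. indicator J r * G c r) \<in> borel_measurable borel" for c
    using borel_measurable_mono_on_fnc[OF G[of c]] J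
    by (subst (asm) borel_measurable_restrict_space_iff) (auto simp: J_def)
  have "(LINT t:A r|M. s t) = indicator J r * G 1 r - indicator J r * G (-1) r" for r
  proof (cases "r \<in> J")
    case True
    have "(LINT t:A r|M. s t) = (LINT t:A r|M. max 0 (1 * s t) - max 0 (-1 * s t))"
      unfolding set_lebesgue_integral_def by (intro Bochner_Integration.integral_cong) (auto split: split_indicator)
    also have "\<dots> = G 1 r - G (-1) r" unfolding G_def
      by (rule set_integral_diff) (rule pos[OF True])+
    finally show ?thesis using True by simp
  next
    case False
    then show ?thesis
      by (simp add: J_def set_integrable_def set_lebesgue_integral_def not_integrable_integral_eq)
  qed
  then show "(\<lambda>r. LINT t:A r|M. s t) \<in> borel_measurable borel" by simp
qed

text \<open>Applied with the cell endpoints: the average is measurable even though nothing is known of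
  \<open>s\<close> outside \<open>[0, 1)\<close>, where the endpoints may lie for exceptional \<open>\<xi>\<close>.\<close>

lemma borel_measurable_average_around:
  fixes s :: "real \<Rightarrow> real"
  assumes [measurable]: "l \<in> borel_measurable M" "r \<in> borel_measurable M"
    and lr: "\<And>w. w \<in> space M \<Longrightarrow> l w \<le> x \<and> x < r w"
  shows "(\<lambda>w. 1 / measure lborel {l w..<r w} * (LINT t:{l w..<r w}|lborel. s t)) \<in> borel_measurable M"
proof -
  \<comment> \<open>Splitting at \<open>x\<close> separates the two endpoints; the sign makes \<open>A\<close> increasing.\<close>
  define A where "A = (\<lambda>m. {- m..<x})"
  define B where "B = (\<lambda>m. {x..<m})"
  have A: "mono A" "A m \<in> sets lborel" for m by (auto simp: A_def mono_def)
  have B: "mono B" "B m \<in> sets lborel" for m by (auto simp: B_def mono_def)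
  note mA[measurable] = borel_measurable_set_integral_mono[OF A, of s]
  note mB[measurable] = borel_measurable_set_integral_mono[OF B, of s]
  have "1 / measure lborel {l w..<r w} * (LINT t:{l w..<r w}|lborel. s t) =
    1 / (r w - l w) * (indicator {m. set_integrable lborel (A m) s} (- l w) *
      indicator {m. set_integrable lborel (B m) s} (r w) *
      ((LINT t:A (- l w)|lborel. s t) + (LINT t:B (r w)|lborel. s t)))" if w: "w \<in> space M" for w
  proof -
    have un: "{l w..<r w} = A (- l w) \<union> B (r w)" and dj: "A (- l w) \<inter> B (r w) = {}"
      using lr[OF w] by (auto simp: A_def B_def)
    show ?thesis
    proof (cases "set_integrable lborel (A (- l w)) s \<and> set_integrable lborel (B (r w)) s")
      case True
      then show ?thesis using lr[OF w] unfolding un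
        by (subst set_integral_Un[OF dj]) (auto simp: un[symmetric])
    next
      case False
      then have "\<not> set_integrable lborel {l w..<r w} s"
        using set_integrable_subset[of lborel "{l w..<r w}" s "A (- l w)"]
          set_integrable_subset[of lborel "{l w..<r w}" s "B (r w)"] A B un by auto
      then have "(LINT t:{l w..<r w}|lborel. s t) = 0"
        by (simp add: set_integrable_def set_lebesgue_integral_def not_integrable_integral_eq)
      then show ?thesis using False by auto
    qed
  qed
  then show ?thesis by (subst measurable_cong) (assumption, measurable)
qed

section \<open>Probability and integration tools\<close>

text \<open>The law of \<open>(\<xi> 0, \<dots>, \<xi> (k - 1))\<close>.\<close>

abbreviation unifs :: "nat \<Rightarrow> (nat \<Rightarrow> real) measure" where
  "unifs k \<equiv> Pi\<^sub>M {..<k} (\<lambda>_. unif01)"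

lemma sets_unif01 [measurable_cong, simp]: "sets unif01 = sets borel"
  by (simp add: unif01_def)

lemma space_unif01 [simp]: "space unif01 = UNIV"
  by (simp add: unif01_def)

lemma prob_space_unifs: "prob_space (unifs k)"
  by (intro prob_space_PiM prob_space_unif01)

lemma AE_unifs: "AE \<xi> in unifs k. \<forall>i<k. 0 \<le> \<xi> i \<and> \<xi> i < 1"
proof -
  have "AE t in unif01. 0 \<le> t \<and> t < 1"
    unfolding unif01_def by (rule AE_uniform_measureI) auto
  then have "AE \<xi> in unifs k. \<forall>i\<in>{..<k}. 0 \<le> \<xi> i \<and> \<xi> i < 1"
    by (intro eventually_ball_finite ballI AE_PiM_component[where P="\<lambda>t. 0 \<le> t \<and> t < 1"] prob_space_unif01) auto
  then show ?thesis by eventually_elim auto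
qed

lemma prob_unifs_avoid:
  assumes [measurable]: "I \<in> sets borel" and I: "I \<subseteq> {0..<1}"
  shows "measure (unifs k) {\<xi> \<in> space (unifs k). \<forall>i<k. \<xi> i \<notin> I} = (1 - measure lborel I) ^ k"
proof -
  interpret product_prob_space "\<lambda>_. unif01" "{..<k}"
    by (intro product_prob_spaceI prob_space_unif01)
  interpret finite_product_prob_space "\<lambda>_. unif01" "{..<k}"
    by unfold_locales simp
  have "{\<xi> \<in> space (unifs k). \<forall>i<k. \<xi> i \<notin> I} = (\<Pi>\<^sub>E i\<in>{..<k}. - I)"
    unfolding space_PiM PiE_def Pi_def by auto
  then have "measure (unifs k) {\<xi> \<in> space (unifs k). \<forall>i<k. \<xi> i \<notin> I} = (\<Prod>i<k. measure unif01 (- I))"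
    using prob_times[of "\<lambda>_. - I"] by (simp add: assms(1) borel_comp)
  moreover have "measure unif01 (- I) = 1 - measure lborel I"
  proof -
    have "measure unif01 I = measure lborel I"
      unfolding unif01_def using I by (subst measure_uniform_measure) (auto simp: Int_absorb1)
    then show ?thesis using prob_space.prob_compl[OF prob_space_unif01, of I] unfolding Compl_eq_Diff_UNIV by simp
  qed
  ultimately show ?thesis by simp
qed

text \<open>The layer-cake formula with a weight \<open>Z\<close>. The weight allows a second application to the
  remaining factor, which gives the mixed moment of the two gaps.\<close>

lemma (in prob_space) expectation_layer_cake:
  fixes Z V :: "'a \<Rightarrow> real"
  assumes [measurable]: "Z \<in> borel_measurable M" "V \<in> borel_measurable M"
    and V: "\<And>w. w \<in> space M \<Longrightarrow> 0 \<le> V w \<and> V w \<le> c"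
    and Z: "\<And>w. w \<in> space M \<Longrightarrow> \<bar>Z w\<bar> \<le> B"
  shows "expectation (\<lambda>w. Z w * V w ^ Suc m) =
    (LINT v:{0..<c}|lborel. (real (Suc m) * v ^ m) * expectation (\<lambda>w. Z w * indicator {w. v < V w} w))"
proof -
  interpret pair_sigma_finite M lborel ..
  let ?f = "\<lambda>w v. indicator {0..<c} v * ((real (Suc m) * v ^ m) * (Z w * indicator {w. v < V w} w))"
  have [measurable]: "(\<lambda>(w, v). ?f w v) \<in> borel_measurable (M \<Otimes>\<^sub>M lborel)"
    by measurable
  have int: "integrable (M \<Otimes>\<^sub>M lborel) (\<lambda>(w, v). ?f w v)"
  proof (rule integrableI_bounded_set[where A="space M \<times> {0..c}" and B="(real (Suc m) * \<bar>c\<bar> ^ m) * \<bar>B\<bar>"])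
    show "emeasure (M \<Otimes>\<^sub>M lborel) (space M \<times> {0..c}) < \<infinity>"
      by (subst lborel.emeasure_pair_measure_Times)
         (auto simp: emeasure_space_1 emeasure_lborel_Icc_eq)
    have "norm (?f w v) \<le> (real (Suc m) * \<bar>c\<bar> ^ m) * \<bar>B\<bar>" if "w \<in> space M" for w v
    proof (cases "v \<in> {0..<c}")
      case True
      have "\<bar>Z w * indicator {w. v < V w} w\<bar> \<le> \<bar>B\<bar>" using Z[OF that] by (auto split: split_indicator)
      moreover have "\<bar>real (Suc m) * v ^ m\<bar> \<le> real (Suc m) * \<bar>c\<bar> ^ m"
        using True by (auto simp: abs_mult power_abs intro!: mult_left_mono power_mono)
      ultimately have "\<bar>(real (Suc m) * v ^ m) * (Z w * indicator {w. v < V w} w)\<bar> \<le> (real (Suc m) * \<bar>c\<bar> ^ m) * \<bar>B\<bar>"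
        by (subst abs_mult) (intro mult_mono, auto)
      then show ?thesis using True by simp
    qed auto
    then show "AE x in M \<Otimes>\<^sub>M lborel. x \<in> space M \<times> {0..c} \<longrightarrow>
        norm (case x of (w, v) \<Rightarrow> ?f w v) \<le> (real (Suc m) * \<bar>c\<bar> ^ m) * \<bar>B\<bar>"
      by (intro AE_I2) auto
    show "AE x in M \<Otimes>\<^sub>M lborel. x \<notin> space M \<times> {0..c} \<longrightarrow> (case x of (w, v) \<Rightarrow> ?f w v) = 0"
      by (intro AE_I2) (auto simp: space_pair_measure indicator_def split: if_splits)
  qed auto
  have inner: "(LINT v|lborel. ?f w v) = Z w * V w ^ Suc m" if w: "w \<in> space M" for w
  proof -
    have "(LINT v|lborel. ?f w v) = Z w * (LINT v|lborel. (real (Suc m) * v ^ m) * indicator {0..<V w} v)"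
      using V[OF w] by (subst Bochner_Integration.integral_mult_right_zero[symmetric], intro Bochner_Integration.integral_cong)
        (auto split: split_indicator)
    also have "(LINT v|lborel. (real (Suc m) * v ^ m) * indicator {0..<V w} v) =
        (LINT v|lborel. (real (Suc m) * v ^ m) * indicator {0..V w} v)"
      by (intro integral_cong_AE eventually_mono[OF AE_lborel_singleton[of "V w"]]) (auto split: split_indicator)
    also have "\<dots> = V w ^ Suc m - 0 ^ Suc m"
      by (rule integral_FTC_Icc_real)
         (use V[OF w] DERIV_pow[of "Suc m"] in \<open>auto intro!: continuous_intros\<close>)
    finally show ?thesis by simp
  qed
  have "expectation (\<lambda>w. Z w * V w ^ Suc m) = (LINT w|M. (LINT v|lborel. ?f w v))"
    by (rule Bochner_Integration.integral_cong[OF refl], rule inner[symmetric])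
  also have "\<dots> = (LINT v|lborel. (LINT w|M. ?f w v))"
    by (rule Fubini_integral[OF int, symmetric])
  also have "\<dots> = (LINT v:{0..<c}|lborel. (real (Suc m) * v ^ m) * expectation (\<lambda>w. Z w * indicator {w. v < V w} w))"
    by (simp add: set_lebesgue_integral_def)
  finally show ?thesis .
qed

lemma set_integral_FTC:
  fixes F f :: "real \<Rightarrow> real"
  assumes "a \<le> b" "\<And>x. a \<le> x \<Longrightarrow> x \<le> b \<Longrightarrow> (F has_real_derivative f x) (at x)" "\<And>x. a \<le> x \<Longrightarrow> x \<le> b \<Longrightarrow> isCont f x"
    and [measurable]: "f \<in> borel_measurable borel"
  shows "set_integrable lborel {a..<b} f" "(LINT x:{a..<b}|lborel. f x) = F b - F a"
proof -
  have I: "set_integrable lborel {a..b} f"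
    by (rule borel_integrable_atLeastAtMost') (use assms(3) in \<open>auto intro: continuous_at_imp_continuous_on\<close>)
  show "set_integrable lborel {a..<b} f"
    by (rule set_integrable_subset[OF I]; auto)
  have "(LINT x|lborel. f x * indicator {a..b} x) = F b - F a"
    by (rule integral_FTC_Icc_real[OF assms(1-3)])
  then have E: "(LINT x:{a..b}|lborel. f x) = F b - F a"
    by (simp add: set_lebesgue_integral_def mult.commute)
  have "(LINT x:{a..<b}|lborel. f x) = (LINT x:{a..b}|lborel. f x)"
    unfolding set_lebesgue_integral_def
    by (intro integral_cong_AE eventually_mono[OF AE_lborel_singleton[of b]]) (auto split: split_indicator)
  then show "(LINT x:{a..<b}|lborel. f x) = F b - F a" using E by simp
qed

lemma set_integral_Ioo_eq_Ico:
  fixes f :: "real \<Rightarrow> real"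
  assumes "set_integrable lborel {a<..<b} f"
  shows "set_integrable lborel {a..<b} f" "(LINT x:{a..<b}|lborel. f x) = (LINT x:{a<..<b}|lborel. f x)"
proof -
  have ae: "AE x in lborel. x \<in> {a<..<b} \<longleftrightarrow> x \<in> {a..<b}"
    by (intro eventually_mono[OF AE_lborel_singleton[of a]]) auto
  let ?g = "\<lambda>x. indicator {a<..<b} x * f x + indicator {a..<b} a * indicator {a} x * f a"
  have eq: "indicator {a..<b} x *\<^sub>R f x = ?g x" for x
    by (auto split: split_indicator)
  have g: "integrable lborel ?g"
    using assms by (auto simp: set_integrable_def)
  then show "set_integrable lborel {a..<b} f" unfolding set_integrable_def eq .
  show "(LINT x:{a..<b}|lborel. f x) = (LINT x:{a<..<b}|lborel. f x)"
    unfolding set_lebesgue_integral_def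
  proof (rule integral_cong_AE)
    show "AE x in lborel. indicator {a..<b} x *\<^sub>R f x = indicator {a<..<b} x *\<^sub>R f x"
      using ae by eventually_elim (auto split: split_indicator)
  qed (use g assms in \<open>auto simp: set_integrable_def eq simp del: real_scaleR_def\<close>)
qed

lemma abs_set_integral_diff_le:
  fixes f g h :: "real \<Rightarrow> real"
  assumes "set_integrable M A f" "set_integrable M A g" "set_integrable M A h"
    and "\<And>x. x \<in> A \<Longrightarrow> \<bar>f x - g x\<bar> \<le> h x"
  shows "\<bar>(LINT x:A|M. f x) - (LINT x:A|M. g x)\<bar> \<le> (LINT x:A|M. h x)"
proof -
  have d: "set_integrable M A (\<lambda>x. f x - g x)" using assms by auto
  have "\<bar>(LINT x:A|M. f x) - (LINT x:A|M. g x)\<bar> = \<bar>LINT x:A|M. f x - g x\<bar>"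
    using assms by (subst set_integral_diff) auto
  also have "\<dots> \<le> (LINT x:A|M. \<bar>f x - g x\<bar>)"
    using integral_abs_bound[of M "\<lambda>x. indicator A x * (f x - g x)"]
    by (simp add: set_lebesgue_integral_def abs_mult)
  also have "\<dots> \<le> (LINT x:A|M. h x)"
    using assms by (intro set_integral_mono set_integrable_abs d) auto
  finally show ?thesis .
qed

section \<open>Moments of the gaps around a point\<close>

text \<open>The distances from \<open>x\<close> to the two ends of its cell. Clipping the endpoints to \<open>[0, 1]\<close> changes
  nothing almost surely and makes the bounds on the gaps hold everywhere.\<close>

definition left_gap :: "nat \<Rightarrow> real \<Rightarrow> (nat \<Rightarrow> real) \<Rightarrow> real" where
  "left_gap k x \<xi> = x - max 0 (left_end k \<xi> x)"

definition right_gap :: "nat \<Rightarrow> real \<Rightarrow> (nat \<Rightarrow> real) \<Rightarrow> real" where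
  "right_gap k x \<xi> = min 1 (right_end k \<xi> x) - x"

lemma measurable_gaps [measurable]:
  "left_gap k x \<in> borel_measurable (unifs k)" "right_gap k x \<in> borel_measurable (unifs k)"
  unfolding left_gap_def right_gap_def by measurable

lemma gap_bounds:
  assumes "0 \<le> x" "x < 1"
  shows "0 \<le> left_gap k x \<xi>" "left_gap k x \<xi> \<le> x" "0 < right_gap k x \<xi>" "right_gap k x \<xi> \<le> 1 - x"
  using left_end_le[OF assms(1), of k \<xi>] right_end_gt[OF assms(2), of k \<xi>] assms
  by (auto simp: left_gap_def right_gap_def)

lemma less_left_gap_iff:
  assumes "0 \<le> d" "d < x"
  shows "d < left_gap k x \<xi> \<longleftrightarrow> (\<forall>i<k. \<xi> i \<notin> {x - d..x})"
proof -
  have "d < left_gap k x \<xi> \<longleftrightarrow> \<not> x - d \<le> left_end k \<xi> x"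
    using assms by (auto simp: left_gap_def)
  then show ?thesis using assms unfolding left_end_ge_iff by auto
qed

lemma less_right_gap_iff:
  assumes "0 \<le> u" "u < 1 - x"
  shows "u < right_gap k x \<xi> \<longleftrightarrow> (\<forall>i<k. \<xi> i \<notin> {x<..x + u})"
proof -
  have "u < right_gap k x \<xi> \<longleftrightarrow> \<not> right_end k \<xi> x \<le> x + u"
    using assms by (auto simp: right_gap_def)
  then show ?thesis using assms unfolding right_end_le_iff by auto
qed

lemma prob_less_left_gap:
  assumes "0 \<le> d" "d < x" "x < 1"
  shows "(LINT \<xi>|unifs k. indicator {\<xi>. d < left_gap k x \<xi>} \<xi>) = (1 - d) ^ k"
proof -
  have "(LINT \<xi>|unifs k. indicator {\<xi>. d < left_gap k x \<xi>} \<xi>) =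
      (LINT \<xi>|unifs k. indicator {\<xi> \<in> space (unifs k). \<forall>i<k. \<xi> i \<notin> {x - d..x}} \<xi>)"
    using assms by (intro Bochner_Integration.integral_cong) (auto simp: less_left_gap_iff split: split_indicator)
  also have "\<dots> = (1 - d) ^ k"
    using prob_unifs_avoid[of "{x - d..x}" k] assms by (simp add: subset_eq)
  finally show ?thesis .
qed

lemma prob_less_right_gap:
  assumes "0 \<le> u" "u < 1 - x" "0 \<le> x"
  shows "(LINT \<xi>|unifs k. indicator {\<xi>. u < right_gap k x \<xi>} \<xi>) = (1 - u) ^ k"
proof -
  have "(LINT \<xi>|unifs k. indicator {\<xi>. u < right_gap k x \<xi>} \<xi>) =
      (LINT \<xi>|unifs k. indicator {\<xi> \<in> space (unifs k). \<forall>i<k. \<xi> i \<notin> {x<..x + u}} \<xi>)"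
    using assms by (intro Bochner_Integration.integral_cong) (auto simp: less_right_gap_iff split: split_indicator)
  also have "\<dots> = (1 - u) ^ k"
    using prob_unifs_avoid[of "{x<..x + u}" k] assms by (simp add: subset_eq)
  finally show ?thesis .
qed

lemma prob_less_gaps:
  assumes "0 \<le> d" "d < x" "0 \<le> u" "u < 1 - x"
  shows "(LINT \<xi>|unifs k. indicator {\<xi>. u < right_gap k x \<xi>} \<xi> * indicator {\<xi>. d < left_gap k x \<xi>} \<xi>) =
    (1 - u - d) ^ k"
proof -
  have "t \<in> {x - d..x + u} \<longleftrightarrow> t \<in> {x - d..x} \<or> t \<in> {x<..x + u}" for t using assms by auto
  then have "u < right_gap k x \<xi> \<and> d < left_gap k x \<xi> \<longleftrightarrow> (\<forall>i<k. \<xi> i \<notin> {x - d..x + u})" for \<xi>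
    unfolding less_left_gap_iff[OF assms(1,2)] less_right_gap_iff[OF assms(3,4)] by blast
  then have "(LINT \<xi>|unifs k. indicator {\<xi>. u < right_gap k x \<xi>} \<xi> * indicator {\<xi>. d < left_gap k x \<xi>} \<xi> :: real) =
      (LINT \<xi>|unifs k. indicator {\<xi> \<in> space (unifs k). \<forall>i<k. \<xi> i \<notin> {x - d..x + u}} \<xi>)"
    by (intro Bochner_Integration.integral_cong) (simp_all only: indicator_inter_arith[symmetric] Collect_conj_eq[symmetric], auto simp: indicator_def)
  also have "\<dots> = (1 - u - d) ^ k"
    using prob_unifs_avoid[of "{x - d..x + u}" k] assms by (simp add: subset_eq algebra_simps)
  finally show ?thesis .
qed

lemma expectation_left_gap_power:
  assumes "0 < x" "x < 1"
  shows "(LINT \<xi>|unifs k. left_gap k x \<xi> ^ Suc m) = (LINT d:{0..<x}|lborel. real (Suc m) * d ^ m * (1 - d) ^ k)"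
proof -
  interpret prob_space "unifs k" by (rule prob_space_unifs)
  have "expectation (\<lambda>\<xi>. 1 * left_gap k x \<xi> ^ Suc m) =
    (LINT v:{0..<x}|lborel. (real (Suc m) * v ^ m) * expectation (\<lambda>w. 1 * indicator {w. v < left_gap k x w} w))"
    by (rule expectation_layer_cake[where B=1]) (use assms gap_bounds[of x] in auto)
  also have "\<dots> = (LINT d:{0..<x}|lborel. real (Suc m) * d ^ m * (1 - d) ^ k)"
    by (intro set_lebesgue_integral_cong) (use assms prob_less_left_gap[of _ x k] in auto)
  finally show ?thesis by simp
qed

lemma expectation_right_gap_power:
  assumes "0 < x" "x < 1"
  shows "(LINT \<xi>|unifs k. right_gap k x \<xi> ^ Suc m) = (LINT u:{0..<1 - x}|lborel. real (Suc m) * u ^ m * (1 - u) ^ k)"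
proof -
  interpret prob_space "unifs k" by (rule prob_space_unifs)
  have "expectation (\<lambda>\<xi>. 1 * right_gap k x \<xi> ^ Suc m) =
    (LINT v:{0..<1 - x}|lborel. (real (Suc m) * v ^ m) * expectation (\<lambda>w. 1 * indicator {w. v < right_gap k x w} w))"
    by (rule expectation_layer_cake[where B=1]) (use assms gap_bounds[of x] in \<open>auto intro: less_imp_le\<close>)
  also have "\<dots> = (LINT u:{0..<1 - x}|lborel. real (Suc m) * u ^ m * (1 - u) ^ k)"
    by (intro set_lebesgue_integral_cong) (use assms prob_less_right_gap[of _ x k] in auto)
  finally show ?thesis by simp
qed

lemma expectation_gaps_mult:
  assumes "0 < x" "x < 1"
  shows "(LINT \<xi>|unifs k. left_gap k x \<xi> * right_gap k x \<xi>) =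
    (LINT u:{0..<1 - x}|lborel. (LINT d:{0..<x}|lborel. (1 - u - d) ^ k))"
proof -
  interpret prob_space "unifs k" by (rule prob_space_unifs)
  have "expectation (\<lambda>\<xi>. left_gap k x \<xi> * right_gap k x \<xi> ^ Suc 0) =
    (LINT u:{0..<1 - x}|lborel. (real (Suc 0) * u ^ 0) * expectation (\<lambda>w. left_gap k x w * indicator {w. u < right_gap k x w} w))"
    by (rule expectation_layer_cake[where B=x]) (use assms gap_bounds[of x] in \<open>auto intro: less_imp_le\<close>)
  also have "\<dots> = (LINT u:{0..<1 - x}|lborel. (LINT d:{0..<x}|lborel. (1 - u - d) ^ k))"
  proof (intro set_lebesgue_integral_cong allI impI)
    fix u assume u: "u \<in> {0..<1 - x}"
    have "expectation (\<lambda>w. indicator {w. u < right_gap k x w} w * left_gap k x w ^ Suc 0) =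
      (LINT d:{0..<x}|lborel. (real (Suc 0) * d ^ 0) *
         expectation (\<lambda>w. indicator {w. u < right_gap k x w} w * indicator {w. d < left_gap k x w} w))"
      by (rule expectation_layer_cake[where B=1]) (use assms gap_bounds[of x] in \<open>auto split: split_indicator\<close>)
    also have "\<dots> = (LINT d:{0..<x}|lborel. (1 - u - d) ^ k)"
      by (intro set_lebesgue_integral_cong) (use u prob_less_gaps[of _ x u k] in auto)
    finally show "(real (Suc 0) * u ^ 0) * expectation (\<lambda>w. left_gap k x w * indicator {w. u < right_gap k x w} w) =
      (LINT d:{0..<x}|lborel. (1 - u - d) ^ k)" by (simp add: mult.commute)
  qed auto
  finally show ?thesis by simp
qed

lemma DERIV_reflected_power:
  "((\<lambda>u. (a - u) ^ Suc n / real (Suc n)) has_real_derivative - ((a - u) ^ n)) (at u)"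
proof -
  have "((\<lambda>u. a - u) has_real_derivative - 1) (at u)"
    by (auto intro!: derivative_eq_intros)
  from DERIV_power_Suc[OF this, of n]
  have "((\<lambda>u. (a - u) ^ Suc n) has_real_derivative real (Suc n) * (a - u) ^ n * (- 1)) (at u)"
    by (simp add: mult.commute)
  from DERIV_cdivide[OF this, of "real (Suc n)"] show ?thesis by simp
qed

lemma
  fixes c :: real
  assumes "0 \<le> c"
  shows integral_reflected_power0:
      "(LINT u:{0..<c}|lborel. (a - u) ^ n) = (a ^ (n + 1) - (a - c) ^ (n + 1)) / (n + 1)"
    and integral_reflected_power1:
      "(LINT u:{0..<c}|lborel. 2 * u * (1 - u) ^ n) =
        2 * ((1 - (1 - c) ^ (n + 1)) / (n + 1) - (1 - (1 - c) ^ (n + 2)) / (n + 2))"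
proof -
  let ?F = "\<lambda>m a u::real. - ((a - u) ^ Suc m / real (Suc m))"
  have "(LINT u:{0..<c}|lborel. (a - u) ^ n) = ?F n a c - ?F n a 0"
    by (rule set_integral_FTC(2)[OF assms])
       (auto intro!: continuous_intros DERIV_minus[OF DERIV_reflected_power, simplified])
  then show "(LINT u:{0..<c}|lborel. (a - u) ^ n) = (a ^ (n + 1) - (a - c) ^ (n + 1)) / (n + 1)"
    by (simp add: diff_divide_distrib add.commute)
  have D: "((\<lambda>u. ?F n 1 u - ?F (Suc n) 1 u) has_real_derivative u * (1 - u) ^ n) (at u)" for u
    using DERIV_diff[OF DERIV_minus[OF DERIV_reflected_power[of 1 n u]] DERIV_minus[OF DERIV_reflected_power[of 1 "Suc n" u]]]
    by (simp add: algebra_simps)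
  have "(LINT u:{0..<c}|lborel. u * (1 - u) ^ n) = (?F n 1 c - ?F (Suc n) 1 c) - (?F n 1 0 - ?F (Suc n) 1 0)"
    by (rule set_integral_FTC(2)[OF assms D]) (auto intro!: continuous_intros)
  then have "(LINT u:{0..<c}|lborel. 2 * (u * (1 - u) ^ n)) =
        2 * ((?F n 1 c - ?F (Suc n) 1 c) - (?F n 1 0 - ?F (Suc n) 1 0))"
    by (subst set_integral_mult_right) simp
  then show "(LINT u:{0..<c}|lborel. 2 * u * (1 - u) ^ n) =
        2 * ((1 - (1 - c) ^ (n + 1)) / (n + 1) - (1 - (1 - c) ^ (n + 2)) / (n + 2))"
    by (simp add: mult.assoc diff_divide_distrib)
qed

lemma integral_reflected_power2_le:
  fixes c :: real
  assumes "0 \<le> c" "c \<le> 1"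
  shows "(LINT u:{0..<c}|lborel. 3 * u\<^sup>2 * (1 - u) ^ n) \<le> 6 / ((real n + 1) * (real n + 2) * (real n + 3))"
proof -
  let ?F = "\<lambda>m u::real. - ((1 - u) ^ Suc m / real (Suc m))"
  have "((\<lambda>u. 3 * (?F n u - 2 * ?F (Suc n) u + ?F (Suc (Suc n)) u)) has_real_derivative
      3 * (- (- ((1 - u) ^ n)) - 2 * (- (- ((1 - u) ^ Suc n))) + (- (- ((1 - u) ^ Suc (Suc n)))))) (at u)" for u
    by (intro DERIV_cmult DERIV_add DERIV_diff DERIV_minus DERIV_reflected_power)
  then have D: "((\<lambda>u. 3 * (?F n u - 2 * ?F (Suc n) u + ?F (Suc (Suc n)) u)) has_real_derivative 3 * u\<^sup>2 * (1 - u) ^ n) (at u)" for u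
    by (rule back_subst[of "\<lambda>y. (_ has_real_derivative y) (at u)"]) (simp add: algebra_simps power2_eq_square)
  note F = set_integral_FTC[of 0 1, OF _ D]
  have 1: "set_integrable lborel {0..<1} (\<lambda>u::real. 3 * u\<^sup>2 * (1 - u) ^ n)"
    by (rule F(1)) (auto intro!: continuous_intros)
  have "(LINT u:{0..<c}|lborel. 3 * u\<^sup>2 * (1 - u) ^ n) \<le> (LINT u:{0..<1}|lborel. 3 * u\<^sup>2 * (1 - u) ^ n)"
    unfolding set_lebesgue_integral_def
    using 1 set_integrable_subset[OF 1, of "{0..<c}"] assms unfolding set_integrable_def
    by (intro integral_mono) (auto split: split_indicator)
  also have "\<dots> = 3 * (?F n 1 - 2 * ?F (Suc n) 1 + ?F (Suc (Suc n)) 1) - 3 * (?F n 0 - 2 * ?F (Suc n) 0 + ?F (Suc (Suc n)) 0)"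
    by (rule F(2)) (auto intro!: continuous_intros)
  also have "\<dots> = 3 * (1 / (real n + 1) - 2 / (real n + 2) + 1 / (real n + 3))"
    by (simp add: algebra_simps)
  also have "\<dots> = 6 / ((real n + 1) * (real n + 2) * (real n + 3))"
  proof -
    define a b c where "a = 1 / (real n + 1)" and "b = 1 / (real n + 2)" and "c = 1 / (real n + 3)"
    have "a * (real n + 1) = 1" "b * (real n + 2) = 1" "c * (real n + 3) = 1"
      by (simp_all add: a_def b_def c_def add_nonneg_eq_0_iff)
    then have "3 * (a - 2 * b + c) = 6 * (a * b * c)" by algebra
    then show ?thesis by (simp add: a_def b_def c_def)
  qed
  finally show ?thesis .
qed

lemma expectation_gaps:
  assumes x: "0 < x" "x < 1"
  shows "(LINT \<xi>|unifs k. left_gap k x \<xi>) = (1 - (1 - x) ^ (k + 1)) / (real k + 1)"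
    and "(LINT \<xi>|unifs k. right_gap k x \<xi>) = (1 - x ^ (k + 1)) / (real k + 1)"
    and "(LINT \<xi>|unifs k. (left_gap k x \<xi>)\<^sup>2) =
      2 * ((1 - (1 - x) ^ (k + 1)) / (real k + 1) - (1 - (1 - x) ^ (k + 2)) / (real k + 2))"
    and "(LINT \<xi>|unifs k. (right_gap k x \<xi>)\<^sup>2) =
      2 * ((1 - x ^ (k + 1)) / (real k + 1) - (1 - x ^ (k + 2)) / (real k + 2))"
    and "(LINT \<xi>|unifs k. left_gap k x \<xi> * right_gap k x \<xi>) =
      (1 - x ^ (k + 2) - (1 - x) ^ (k + 2)) / ((real k + 1) * (real k + 2))"
    and "(LINT \<xi>|unifs k. left_gap k x \<xi> ^ 3) \<le> 6 / ((real k + 1) * (real k + 2) * (real k + 3))"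
    and "(LINT \<xi>|unifs k. right_gap k x \<xi> ^ 3) \<le> 6 / ((real k + 1) * (real k + 2) * (real k + 3))"
proof -
  note l = expectation_left_gap_power[OF x, of k] and r = expectation_right_gap_power[OF x, of k]
  show "(LINT \<xi>|unifs k. left_gap k x \<xi>) = (1 - (1 - x) ^ (k + 1)) / (real k + 1)"
    using l[of 0] integral_reflected_power0[of x 1 k] x by (simp add: add.commute)
  show "(LINT \<xi>|unifs k. right_gap k x \<xi>) = (1 - x ^ (k + 1)) / (real k + 1)"
    using r[of 0] integral_reflected_power0[of "1 - x" 1 k] x by (simp add: add.commute)
  show "(LINT \<xi>|unifs k. (left_gap k x \<xi>)\<^sup>2) =
      2 * ((1 - (1 - x) ^ (k + 1)) / (real k + 1) - (1 - (1 - x) ^ (k + 2)) / (real k + 2))"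
    using l[of 1] integral_reflected_power1[of x k] x by (simp add: add.commute power2_eq_square)
  show "(LINT \<xi>|unifs k. (right_gap k x \<xi>)\<^sup>2) =
      2 * ((1 - x ^ (k + 1)) / (real k + 1) - (1 - x ^ (k + 2)) / (real k + 2))"
    using r[of 1] integral_reflected_power1[of "1 - x" k] x by (simp add: add.commute power2_eq_square)
  show "(LINT \<xi>|unifs k. left_gap k x \<xi> ^ 3) \<le> 6 / ((real k + 1) * (real k + 2) * (real k + 3))"
    using l[of 2] integral_reflected_power2_le[of x k] x by (simp add: numeral_3_eq_3)
  show "(LINT \<xi>|unifs k. right_gap k x \<xi> ^ 3) \<le> 6 / ((real k + 1) * (real k + 2) * (real k + 3))"
    using r[of 2] integral_reflected_power2_le[of "1 - x" k] x by (simp add: numeral_3_eq_3)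
  have "(LINT \<xi>|unifs k. left_gap k x \<xi> * right_gap k x \<xi>) =
      (LINT u:{0..<1 - x}|lborel. ((1 - u) ^ (k + 1) - (1 - x - u) ^ (k + 1)) / (real k + 1))"
    unfolding expectation_gaps_mult[OF x]
    by (subst integral_reflected_power0) (use x in \<open>auto simp: algebra_simps\<close>)
  also have "\<dots> = ((LINT u:{0..<1 - x}|lborel. (1 - u) ^ (k + 1)) - (LINT u:{0..<1 - x}|lborel. (1 - x - u) ^ (k + 1))) / (real k + 1)"
  proof -
    have "set_integrable lborel {0..<1 - x} (\<lambda>u. (a - u) ^ (k + 1))" for a
      by (rule set_integrable_subset[OF borel_integrable_atLeastAtMost'[of 0 "1 - x"]])
         (auto intro!: continuous_intros)
    then show ?thesis by (subst set_integral_divide_zero, subst set_integral_diff) auto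
  qed
  also have "\<dots> = (1 - x ^ (k + 2) - (1 - x) ^ (k + 2)) / ((real k + 1) * (real k + 2))"
    using x by (subst (1 2) integral_reflected_power0) (auto simp: diff_divide_distrib ac_simps)
  finally show "(LINT \<xi>|unifs k. left_gap k x \<xi> * right_gap k x \<xi>) =
      (1 - x ^ (k + 2) - (1 - x) ^ (k + 2)) / ((real k + 1) * (real k + 2))" .
qed

text \<open>The \<open>\<sigma>\<close>-algebra of \<^const>\<open>purf\<close> is the final one, so the cell average is measurable on
  partitions because its composition with the partition map is.\<close>

lemma integral_purf_cell_average:
  assumes "0 \<le> x" "x < 1"
  shows "(LINT U|purf k. cell_average s U x) = (LINT \<xi>|unifs k. cell_average s (purf_partition k \<xi>) x)"
proof -
  define N where "N = sigma UNIV {A. purf_partition k -` A \<inter> space (unifs k) \<in> sets (unifs k)}"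
  have comp: "(\<lambda>\<xi>. cell_average s (purf_partition k \<xi>) x) \<in> borel_measurable (unifs k)"
    unfolding cell_average_def partition_cell_purf_partition[OF assms]
    by (rule borel_measurable_average_around) (use left_end_le right_end_gt assms in auto)
  have "(\<lambda>U. cell_average s U x) \<in> borel_measurable N"
  proof (rule measurableI)
    fix A :: "real set" assume "A \<in> sets borel"
    with comp have "(\<lambda>\<xi>. cell_average s (purf_partition k \<xi>) x) -` A \<inter> space (unifs k) \<in> sets (unifs k)"
      by (rule measurable_sets)
    then show "(\<lambda>U. cell_average s U x) -` A \<inter> space N \<in> sets N"
      unfolding N_def space_measure_of_conv Int_UNIV_right
      by (intro in_measure_of) (simp_all add: vimage_def)
  qed simp
  then show ?thesis
    unfolding purf_def Let_def N_def by (rule integral_distr[OF measurable_purf_partition])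
qed

text \<open>The expectations of \<open>(U - D) / 2\<close> and of \<open>(U\<^sup>2 - U * D + D\<^sup>2) / 3\<close>, where \<open>D\<close> and \<open>U\<close> are the
  left and right gaps: the mean over the random cell of \<open>t - x\<close> and of \<open>(t - x)\<^sup>2\<close>.\<close>

definition mean_offset :: "nat \<Rightarrow> real \<Rightarrow> real" where
  "mean_offset k x = ((1 - x) ^ (k + 1) - x ^ (k + 1)) / (2 * (real k + 1))"

definition mean_square :: "nat \<Rightarrow> real \<Rightarrow> real" where
  "mean_square k x = (3 - 2 * (real k + 2) * (x ^ (k + 1) + (1 - x) ^ (k + 1))
     + (2 * real k + 3) * (x ^ (k + 2) + (1 - x) ^ (k + 2))) / (3 * (real k + 1) * (real k + 2))"

lemma integrable_gaps:
  assumes x: "0 < x" "x < 1"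
  shows "integrable (unifs k) (\<lambda>\<xi>. left_gap k x \<xi> ^ m)" "integrable (unifs k) (\<lambda>\<xi>. right_gap k x \<xi> ^ m)"
    "integrable (unifs k) (\<lambda>\<xi>. right_gap k x \<xi> * left_gap k x \<xi>)"
proof -
  interpret prob_space "unifs k" by (rule prob_space_unifs)
  have g: "0 \<le> left_gap k x \<xi>" "left_gap k x \<xi> \<le> 1" "0 \<le> right_gap k x \<xi>" "right_gap k x \<xi> \<le> 1" for \<xi>
    using gap_bounds[of x k \<xi>] x by auto
  show "integrable (unifs k) (\<lambda>\<xi>. left_gap k x \<xi> ^ m)" "integrable (unifs k) (\<lambda>\<xi>. right_gap k x \<xi> ^ m)"
    by (rule integrable_const_bound[where B=1], use g in \<open>auto intro!: power_le_one AE_I2\<close>)+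
  show "integrable (unifs k) (\<lambda>\<xi>. right_gap k x \<xi> * left_gap k x \<xi>)"
    by (rule integrable_const_bound[where B=1], use g in \<open>auto intro!: mult_le_one AE_I2\<close>)
qed

lemma expectation_gap_quadratic:
  assumes x: "0 < x" "x < 1"
  shows "(LINT \<xi>|unifs k. (right_gap k x \<xi>)\<^sup>2 - right_gap k x \<xi> * left_gap k x \<xi> + (left_gap k x \<xi>)\<^sup>2)
    = 3 * mean_square k x"
proof -
  let ?D = "left_gap k x" and ?U = "right_gap k x"
  interpret prob_space "unifs k" by (rule prob_space_unifs)
  define a b X Y X' Y' where defs: "a = 1 / (real k + 1)" "b = 1 / (real k + 2)"
    "X = x ^ (k + 1)" "Y = (1 - x) ^ (k + 1)" "X' = x ^ (k + 2)" "Y' = (1 - x) ^ (k + 2)"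
  have ab: "a * (real k + 1) = 1" "b * (real k + 2) = 1" by (simp_all add: defs add_nonneg_eq_0_iff)
  have "(LINT \<xi>|unifs k. (?U \<xi>)\<^sup>2 - ?U \<xi> * ?D \<xi> + (?D \<xi>)\<^sup>2) =
      expectation (\<lambda>\<xi>. (?U \<xi>)\<^sup>2) - expectation (\<lambda>\<xi>. ?D \<xi> * ?U \<xi>) + expectation (\<lambda>\<xi>. (?D \<xi>)\<^sup>2)"
    using integrable_gaps[OF x] by (simp add: mult.commute[of "?D _"])
  also have "\<dots> = 2 * ((1 - X) * a - (1 - X') * b) - (1 - X' - Y') * (a * b) + 2 * ((1 - Y) * a - (1 - Y') * b)"
    unfolding expectation_gaps[OF x] defs[symmetric] by (simp add: defs(1,2) diff_divide_distrib algebra_simps)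
  also have "\<dots> = (3 - 2 * (real k + 2) * (X + Y) + (2 * real k + 3) * (X' + Y')) * (a * b)"
    using ab by algebra
  also have "\<dots> = 3 * mean_square k x"
  proof -
    have "N * (1 / p * (1 / q)) = 3 * (N / (3 * p * q))" for N p q :: real by simp
    then show ?thesis unfolding mean_square_def defs .
  qed
  finally show ?thesis .
qed

lemma mean_square_nonneg:
  assumes "0 < x" "x < 1"
  shows "0 \<le> mean_square k x"
proof -
  have "0 \<le> u\<^sup>2 - u * d + d\<^sup>2" for u d :: real
  proof -
    have "u\<^sup>2 - u * d + d\<^sup>2 = (u - d / 2)\<^sup>2 + 3 / 4 * d\<^sup>2"
      by (simp add: power2_eq_square field_simps)
    then show ?thesis by simp
  qed
  then have "0 \<le> (LINT \<xi>|unifs k. (right_gap k x \<xi>)\<^sup>2 - right_gap k x \<xi> * left_gap k x \<xi> + (left_gap k x \<xi>)\<^sup>2)"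
    by (intro Bochner_Integration.integral_nonneg)
  then show ?thesis unfolding expectation_gap_quadratic[OF assms] by simp
qed

section \<open>Expected deviation of the cell average\<close>

text \<open>The average of the Taylor polynomial over the cell is computed exactly. The average of
  \<open>C * \<bar>t - x\<bar> ^ 3\<close> is \<open>C / 4 * (U ^ 4 + D ^ 4) / (U + D)\<close>, which is at most
  \<open>C / 4 * (U ^ 3 + D ^ 3)\<close>.\<close>

lemma average_Taylor:
  fixes s s1 s2 :: real and f :: "real \<Rightarrow> real"
  assumes lr: "l \<le> x" "x < r"
    and f: "set_integrable lborel {l..<r} f"
    and T: "\<And>t. t \<in> {l..<r} \<Longrightarrow> \<bar>f t - s - s1 * (t - x) - 1 / 2 * s2 * (t - x)\<^sup>2\<bar> \<le> C * \<bar>t - x\<bar> ^ 3"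
    and C: "0 \<le> C"
  defines "D \<equiv> x - l" and "U \<equiv> r - x"
  shows "\<bar>1 / measure lborel {l..<r} * (LINT t:{l..<r}|lborel. f t) - s
      - s1 * ((U - D) / 2) - s2 / 6 * (U\<^sup>2 - U * D + D\<^sup>2)\<bar> \<le> C / 4 * (U ^ 3 + D ^ 3)"
proof -
  have DU: "0 \<le> D" "0 < U" "0 < U + D" "r - l = U + D" using lr by (auto simp: D_def U_def)
  define p where "p t = s + s1 * (t - x) + 1 / 2 * s2 * (t - x)\<^sup>2" for t
  define P where "P t = s * t + s1 / 2 * (t - x)\<^sup>2 + s2 / 6 * (t - x) ^ 3" for t
  have "(P has_real_derivative p t) (at t)" for t
    unfolding P_def p_def by (auto intro!: derivative_eq_intros simp: power2_eq_square)
  note F = set_integral_FTC[of l r P p, OF _ this]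
  have p: "set_integrable lborel {l..<r} p" "(LINT t:{l..<r}|lborel. p t) = P r - P l"
  proof -
    have c: "isCont p t" for t unfolding p_def by (intro continuous_intros)
    have m: "p \<in> borel_measurable borel" unfolding p_def by measurable
    show "set_integrable lborel {l..<r} p" "(LINT t:{l..<r}|lborel. p t) = P r - P l"
      using lr by (auto intro!: F(1,2) c m)
  qed
  define E where "E t = C * (t - x) ^ 4 / 4" for t
  have "(E has_real_derivative C * (t - x) ^ 3) (at t)" for t
    unfolding E_def by (auto intro!: derivative_eq_intros)
  note FE = set_integral_FTC[of x r E "\<lambda>t. C * (t - x) ^ 3", OF _ this]
  define E' where "E' t = - C * (x - t) ^ 4 / 4" for t
  have "(E' has_real_derivative C * (x - t) ^ 3) (at t)" for t
    unfolding E'_def by (auto intro!: derivative_eq_intros)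
  note FE' = set_integral_FTC[of l x E' "\<lambda>t. C * (x - t) ^ 3", OF _ this]
  have H1: "set_integrable lborel {x..<r} (\<lambda>t. C * \<bar>t - x\<bar> ^ 3)"
    by (subst set_integrable_cong[OF refl refl, where f'="\<lambda>t. C * (t - x) ^ 3"], simp)
       (rule FE(1), use lr in \<open>auto intro!: continuous_intros\<close>)
  have H2: "(LINT t:{x..<r}|lborel. C * \<bar>t - x\<bar> ^ 3) = E r - E x"
    by (subst set_lebesgue_integral_cong[where g="\<lambda>t. C * (t - x) ^ 3"], simp, simp)
       (rule FE(2), use lr in \<open>auto intro!: continuous_intros\<close>)
  have H3: "set_integrable lborel {l..<x} (\<lambda>t. C * \<bar>t - x\<bar> ^ 3)"
    by (subst set_integrable_cong[OF refl refl, where f'="\<lambda>t. C * (x - t) ^ 3"], simp)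
       (rule FE'(1), use lr in \<open>auto intro!: continuous_intros\<close>)
  have H4: "(LINT t:{l..<x}|lborel. C * \<bar>t - x\<bar> ^ 3) = E' x - E' l"
    by (subst set_lebesgue_integral_cong[where g="\<lambda>t. C * (x - t) ^ 3"], simp, simp)
       (rule FE'(2), use lr in \<open>auto intro!: continuous_intros\<close>)
  have un: "{l..<r} = {l..<x} \<union> {x..<r}" using lr by auto
  have Q1: "set_integrable lborel {l..<r} (\<lambda>t. C * \<bar>t - x\<bar> ^ 3)"
    unfolding un by (intro set_integrable_Un H1 H3) auto
  have "(LINT t:{l..<r}|lborel. C * \<bar>t - x\<bar> ^ 3) = (E' x - E' l) + (E r - E x)"
    unfolding un by (subst set_integral_Un[OF _ H3 H1]) (simp_all only: H2 H4, auto)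
  then have Q2: "(LINT t:{l..<r}|lborel. C * \<bar>t - x\<bar> ^ 3) = C / 4 * (U ^ 4 + D ^ 4)"
    by (simp add: E_def E'_def U_def D_def algebra_simps)
  have d: "set_integrable lborel {l..<r} (\<lambda>t. f t - p t)" by (rule set_integral_diff(1)[OF f p(1)])
  have "\<bar>LINT t:{l..<r}|lborel. f t - p t\<bar> \<le> (LINT t:{l..<r}|lborel. \<bar>f t - p t\<bar>)"
    using integral_abs_bound[of lborel "\<lambda>t. indicator {l..<r} t * (f t - p t)"]
    by (simp add: set_lebesgue_integral_def abs_mult)
  also have "\<dots> \<le> (LINT t:{l..<r}|lborel. C * \<bar>t - x\<bar> ^ 3)"
    using T by (intro set_integral_mono set_integrable_abs d Q1) (auto simp: p_def algebra_simps)
  also have "\<dots> \<le> C / 4 * ((U ^ 3 + D ^ 3) * (U + D))"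
  proof -
    have "0 \<le> U * D ^ 3 + D * U ^ 3" using DU by simp
    then have "U ^ 4 + D ^ 4 \<le> (U ^ 3 + D ^ 3) * (U + D)"
      by (simp add: algebra_simps power_numeral_reduce)
    then show ?thesis unfolding Q2 using C by (intro mult_left_mono) auto
  qed
  finally have 1: "\<bar>(LINT t:{l..<r}|lborel. f t) - (P r - P l)\<bar> \<le> C / 4 * (U ^ 3 + D ^ 3) * (U + D)"
    using set_integral_diff(2)[OF f p(1)] p(2) by (simp add: mult.assoc)
  have 2: "P r - P l = (s + s1 * ((U - D) / 2) + s2 / 6 * (U\<^sup>2 - U * D + D\<^sup>2)) * (U + D)"
    unfolding P_def using DU(4)
    by (simp add: U_def D_def field_simps power2_eq_square power3_eq_cube)
  have 3: "measure lborel {l..<r} = U + D" using lr DU by simp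
  have "1 / (U + D) * (LINT t:{l..<r}|lborel. f t) - s - s1 * ((U - D) / 2) - s2 / 6 * (U\<^sup>2 - U * D + D\<^sup>2)
      = ((LINT t:{l..<r}|lborel. f t) - (P r - P l)) / (U + D)"
    using DU(3) unfolding 2 by (simp add: diff_divide_distrib)
  then show ?thesis using 1 DU(3) unfolding 3 by (simp add: pos_divide_le_eq)
qed

text \<open>Functions on \<open>[0, 1)\<close> with a second-order Taylor expansion whose remainder is uniformly cubic.\<close>

locale taylor_bounded =
  fixes s s' s'' :: "real \<Rightarrow> real" and C :: real
  assumes DERIV_s: "x \<in> {0..<1} \<Longrightarrow> (s has_real_derivative s' x) (at x within {0..<1})"
    and DERIV_s': "x \<in> {0..<1} \<Longrightarrow> (s' has_real_derivative s'' x) (at x within {0..<1})"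
    and C_pos: "0 < C"
    and Taylor: "t \<in> {0..<1} \<Longrightarrow> x \<in> {0..<1} \<Longrightarrow>
      \<bar>s t - s x - s' x * (t - x) - 1 / 2 * s'' x * (t - x)\<^sup>2\<bar> \<le> C * \<bar>t - x\<bar> ^ 3"
begin

lemma s_bounded: "t \<in> {0..<1} \<Longrightarrow> \<bar>s t\<bar> \<le> \<bar>s 0\<bar> + \<bar>s' 0\<bar> + \<bar>s'' 0\<bar> + C"
proof -
  assume t: "t \<in> {0..<1}"
  have "\<bar>s' 0 * t\<bar> \<le> \<bar>s' 0\<bar>" using t by (simp add: abs_mult mult_left_le)
  moreover have "\<bar>1 / 2 * s'' 0 * t\<^sup>2\<bar> \<le> \<bar>s'' 0\<bar>"
  proof -
    have "t\<^sup>2 \<le> 1" using t by (simp add: power_le_one)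
    then have "\<bar>s'' 0\<bar> * t\<^sup>2 \<le> \<bar>s'' 0\<bar>" by (rule mult_left_le) simp
    then show ?thesis by (simp add: abs_mult)
  qed
  moreover have "C * \<bar>t\<bar> ^ 3 \<le> C" using t C_pos by (simp add: mult_left_le power_le_one)
  ultimately show ?thesis using Taylor[of t 0] t by simp
qed

text \<open>Comparing the expansions at \<open>x\<close> of the bounded function \<open>s\<close> in \<open>x + h\<close> and \<open>x + 2 * h\<close>, with
  \<open>h = \<plusminus> 1/4\<close> pointing into \<open>[0, 1)\<close>, gives, up to bounded errors, two independent linear equations for \<open>s' x\<close> and \<open>s'' x\<close>.\<close>

lemma derivatives_bounded: "\<exists>K. \<forall>x\<in>{0..<1}. \<bar>s' x\<bar> \<le> K \<and> \<bar>s'' x\<bar> \<le> K"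
proof -
  define B where "B = \<bar>s 0\<bar> + \<bar>s' 0\<bar> + \<bar>s'' 0\<bar> + C"
  have "\<bar>s' x\<bar> \<le> 64 * B + 3 * C \<and> \<bar>s'' x\<bar> \<le> 64 * B + 3 * C" if x: "x \<in> {0..<1}" for x
  proof -
    define h :: real where "h = (if x < 1/2 then 1/4 else - 1/4)"
    have mem: "x + h \<in> {0..<1}" "x + 2 * h \<in> {0..<1}" using x by (auto simp: h_def)
    have h: "\<bar>h\<bar> = 1/4" "h\<^sup>2 = 1/16" by (auto simp: h_def power2_eq_square)
    have T: "\<bar>s (x + h) - s x - s' x * h - s'' x / 32\<bar> \<le> C / 64"
      using Taylor[OF mem(1) x] by (simp add: h power3_eq_cube)
    have T2: "\<bar>s (x + 2 * h) - s x - 2 * (s' x * h) - s'' x / 8\<bar> \<le> C / 8"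
      using Taylor[OF mem(2) x] by (simp add: h abs_mult power_mult_distrib power3_eq_cube mult.left_commute)
    have b: "\<bar>s x\<bar> \<le> B" "\<bar>s (x + h)\<bar> \<le> B" "\<bar>s (x + 2 * h)\<bar> \<le> B"
      using s_bounded x mem unfolding B_def by auto
    define e where "e = s (x + h) - s x - s' x * h - s'' x / 32"
    define e2 where "e2 = s (x + 2 * h) - s x - 2 * (s' x * h) - s'' x / 8"
    have e: "\<bar>e\<bar> \<le> C / 64" "\<bar>e2\<bar> \<le> C / 8" using T T2 unfolding e_def e2_def .
    have "2 * (s' x * h) = 4 * s (x + h) - 3 * s x - s (x + 2 * h) - 4 * e + e2"
      unfolding e_def e2_def by (simp add: algebra_simps)
    then have "2 * \<bar>s' x * h\<bar> \<le> 4 * \<bar>s (x + h)\<bar> + 3 * \<bar>s x\<bar> + \<bar>s (x + 2 * h)\<bar> + 4 * \<bar>e\<bar> + \<bar>e2\<bar>" by linarith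
    also have "\<dots> \<le> 4 * B + 3 * B + B + 4 * (C / 64) + C / 8" by (intro add_mono mult_left_mono b e) auto
    finally have 1: "\<bar>s' x\<bar> \<le> 16 * B + 3 / 8 * C" using h by (simp add: abs_mult)
    have "s'' x = 16 * s (x + 2 * h) - 32 * s (x + h) + 16 * s x + 32 * e - 16 * e2"
      unfolding e_def e2_def by (simp add: algebra_simps)
    then have "\<bar>s'' x\<bar> \<le> 16 * \<bar>s (x + 2 * h)\<bar> + 32 * \<bar>s (x + h)\<bar> + 16 * \<bar>s x\<bar> + 32 * \<bar>e\<bar> + 16 * \<bar>e2\<bar>" by linarith
    also have "\<dots> \<le> 16 * B + 32 * B + 16 * B + 32 * (C / 64) + 16 * (C / 8)" by (intro add_mono mult_left_mono b e) auto
    finally have 2: "\<bar>s'' x\<bar> \<le> 64 * B + 5 / 2 * C" by simp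
    have "0 \<le> B" using b(1) by linarith
    then show ?thesis using 1 2 C_pos by simp
  qed
  then show ?thesis by blast
qed

lemma set_integrable_s: "set_integrable lborel {0..<1} s"
  unfolding set_integrable_def
proof (rule integrableI_bounded_set[where A="{0..<1}"])
  have "continuous_on {0..<1} s"
    by (auto simp: continuous_on_eq_continuous_within intro!: DERIV_continuous[OF DERIV_s])
  then show "(\<lambda>x. indicator {0..<1} x *\<^sub>R s x) \<in> borel_measurable lborel"
    using borel_measurable_continuous_on_indicator[of "{0..<1}" s] by simp
  show "AE x in lborel. x \<in> {0..<1} \<longrightarrow> norm (indicator {0..<1} x *\<^sub>R s x) \<le> \<bar>s 0\<bar> + \<bar>s' 0\<bar> + \<bar>s'' 0\<bar> + C"
    using s_bounded by (intro AE_I2) auto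
qed auto

lemma expected_deviation:
  assumes x: "0 < x" "x < 1"
  shows "\<bar>(LINT U|purf k. cell_average s U x) - s x - s' x * mean_offset k x - s'' x / 2 * mean_square k x\<bar>
    \<le> 3 * C / ((real k + 1) * (real k + 2) * (real k + 3))"
proof -
  interpret prob_space "unifs k" by (rule prob_space_unifs)
  let ?D = "left_gap k x" and ?U = "right_gap k x"
  let ?A = "\<lambda>\<xi>. cell_average s (purf_partition k \<xi>) x"
  let ?p = "\<lambda>\<xi>. s x + s' x * ((?U \<xi> - ?D \<xi>) / 2) + s'' x / 6 * ((?U \<xi>)\<^sup>2 - ?U \<xi> * ?D \<xi> + (?D \<xi>)\<^sup>2)"
  let ?e = "\<lambda>\<xi>. C / 4 * (?U \<xi> ^ 3 + ?D \<xi> ^ 3)"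
  have Aeq: "?A \<xi> = 1 / measure lborel {left_end k \<xi> x..<right_end k \<xi> x} *
      (LINT t:{left_end k \<xi> x..<right_end k \<xi> x}|lborel. s t)" for \<xi> :: "nat \<Rightarrow> real"
    using x unfolding cell_average_def by (subst (1 2) partition_cell_purf_partition) auto
  have [measurable]: "?A \<in> borel_measurable (unifs k)"
    unfolding Aeq by (rule borel_measurable_average_around) (use left_end_le[of x k] right_end_gt[of x k] x in auto)
  have bnd: "AE \<xi> in unifs k. \<bar>?A \<xi> - ?p \<xi>\<bar> \<le> ?e \<xi>"
    using AE_unifs
  proof eventually_elim
    fix \<xi> :: "nat \<Rightarrow> real" assume \<xi>: "\<forall>i<k. 0 \<le> \<xi> i \<and> \<xi> i < 1"
    have l: "0 \<le> left_end k \<xi> x" "left_end k \<xi> x \<le> x" and r: "x < right_end k \<xi> x" "right_end k \<xi> x \<le> 1"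
      using left_end_mem[of k \<xi> x] right_end_mem[of k \<xi> x] \<xi> left_end_le[of x k \<xi>] right_end_gt[of x k \<xi>] x
      by (force simp: less_imp_le)+
    have "set_integrable lborel {left_end k \<xi> x..<right_end k \<xi> x} s"
      by (rule set_integrable_subset[OF set_integrable_s]) (use l r in auto)
    from average_Taylor[OF l(2) r(1) this, of "s x" "s' x" "s'' x" C] Taylor[of _ x] C_pos l r x
    show "\<bar>?A \<xi> - ?p \<xi>\<bar> \<le> ?e \<xi>"
      unfolding Aeq by (simp add: left_gap_def right_gap_def algebra_simps)
  qed
  note [simp, intro] = integrable_gaps(1)[OF x, of _ 1, simplified] integrable_gaps(2)[OF x, of _ 1, simplified]
    integrable_gaps(1)[OF x, of _ 2] integrable_gaps(2)[OF x, of _ 2]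
    integrable_gaps(1)[OF x, of _ 3] integrable_gaps(2)[OF x, of _ 3] integrable_gaps(3)[OF x]
  have ip: "integrable (unifs k) ?p" and ie: "integrable (unifs k) ?e" by auto
  have idev: "integrable (unifs k) (\<lambda>\<xi>. ?A \<xi> - ?p \<xi>)"
    by (rule Bochner_Integration.integrable_bound[OF ie]) (measurable, use bnd in \<open>eventually_elim, auto\<close>)
  then have iA: "integrable (unifs k) ?A" using Bochner_Integration.integrable_add[OF idev ip] by simp
  have "\<bar>expectation ?A - expectation ?p\<bar> = \<bar>expectation (\<lambda>\<xi>. ?A \<xi> - ?p \<xi>)\<bar>"
    using iA ip by simp
  also have "\<dots> \<le> expectation (\<lambda>\<xi>. \<bar>?A \<xi> - ?p \<xi>\<bar>)" by (rule integral_abs_bound)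
  also have "\<dots> \<le> expectation ?e"
    by (rule integral_mono_AE[OF integrable_abs[OF idev] ie bnd])
  also have "\<dots> = C / 4 * (expectation (\<lambda>\<xi>. ?U \<xi> ^ 3) + expectation (\<lambda>\<xi>. ?D \<xi> ^ 3))" by simp
  also have "\<dots> \<le> C / 4 * (12 / ((real k + 1) * (real k + 2) * (real k + 3)))"
    using expectation_gaps(6,7)[OF x, of k] C_pos by (intro mult_left_mono) auto
  finally have 1: "\<bar>expectation ?A - expectation ?p\<bar> \<le> 3 * C / ((real k + 1) * (real k + 2) * (real k + 3))"
    by simp
  have "expectation ?p = s x + s' x * ((expectation ?U - expectation ?D) / 2) +
      s'' x / 6 * expectation (\<lambda>\<xi>. (?U \<xi>)\<^sup>2 - ?U \<xi> * ?D \<xi> + (?D \<xi>)\<^sup>2)"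
    by (simp add: prob_space)
  moreover have "(expectation ?U - expectation ?D) / 2 = mean_offset k x"
    unfolding expectation_gaps[OF x] mean_offset_def by (simp add: diff_divide_distrib mult.commute)
  moreover note expectation_gap_quadratic[OF x, of k]
  ultimately have "expectation ?p = s x + s' x * mean_offset k x + s'' x / 2 * mean_square k x" by simp
  with 1 x show ?thesis by (subst integral_purf_cell_average) (auto simp: algebra_simps)
qed

end

section \<open>Estimates for the bias at a point\<close>

lemma mean_offset_bounds:
  assumes "0 < x" "x < 1" "0 < k"
  shows "\<bar>mean_offset k x\<bar> \<le> 1 / (2 * real k)"
    and "\<bar>mean_offset k x - ((1 - x) ^ (k + 1) - x ^ (k + 1)) / (2 * real k)\<bar> \<le> 1 / (2 * (real k)\<^sup>2)"
proof -
  define g where "g = (1 - x) ^ (k + 1) - x ^ (k + 1)"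
  have "0 \<le> x ^ (k + 1)" "x ^ (k + 1) \<le> 1" "0 \<le> (1 - x) ^ (k + 1)" "(1 - x) ^ (k + 1) \<le> 1"
    using assms by (auto intro!: power_le_one zero_le_power simp del: power_Suc)
  then have g: "\<bar>g\<bar> \<le> 1" unfolding g_def by linarith
  have k: "0 < real k" using assms by simp
  have "\<bar>mean_offset k x\<bar> = \<bar>g\<bar> / (2 * (real k + 1))"
    by (simp add: mean_offset_def g_def abs_divide)
  also have "\<dots> \<le> 1 / (2 * real k)" using g k by (intro frac_le) auto
  finally show "\<bar>mean_offset k x\<bar> \<le> 1 / (2 * real k)" .
  have "g / (2 * (real k + 1)) - g / (2 * real k) = - (g / (2 * real k * (real k + 1)))"
    using k by (simp add: divide_simps) algebra
  then have "\<bar>mean_offset k x - g / (2 * real k)\<bar> = \<bar>g\<bar> / (2 * real k * (real k + 1))"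
    unfolding mean_offset_def g_def[symmetric] by (simp add: abs_divide)
  also have "\<dots> \<le> 1 / (2 * (real k)\<^sup>2)" using g k by (intro frac_le) (auto simp: power2_eq_square)
  finally show "\<bar>mean_offset k x - ((1 - x) ^ (k + 1) - x ^ (k + 1)) / (2 * real k)\<bar> \<le> 1 / (2 * (real k)\<^sup>2)"
    unfolding g_def .
qed

lemma mean_square_eq:
  fixes x :: real
  defines "T \<equiv> \<lambda>k. 2 * (real k + 2) * (x ^ (k + 1) + (1 - x) ^ (k + 1)) - (2 * real k + 3) * (x ^ (k + 2) + (1 - x) ^ (k + 2))"
  assumes "0 < x" "x < 1"
  shows "mean_square k x = 1 / ((real k + 1) * (real k + 2)) - T k / (3 * (real k + 1) * (real k + 2))"
    and "0 \<le> T k" and "T k \<le> 2 * (real k + 2) * (x ^ (k + 1) + (1 - x) ^ (k + 1))"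
proof -
  have "3 / (3 * p * q) = 1 / (p * q)" for p q :: real by simp
  moreover have "mean_square k x = (3 - T k) / (3 * (real k + 1) * (real k + 2))"
    unfolding mean_square_def T_def by (rule arg_cong[where f="\<lambda>z. z / _"]) simp
  ultimately show "mean_square k x = 1 / ((real k + 1) * (real k + 2)) - T k / (3 * (real k + 1) * (real k + 2))"
    by (simp only: diff_divide_distrib)
  have 1: "x ^ (k + 2) \<le> x ^ (k + 1)" "(1 - x) ^ (k + 2) \<le> (1 - x) ^ (k + 1)"
    using assms by (auto intro!: power_decreasing simp del: power_Suc)
  have 2: "0 \<le> x ^ (k + 2)" "0 \<le> (1 - x) ^ (k + 2)" using assms by simp_all
  have "(2 * real k + 3) * (x ^ (k + 2) + (1 - x) ^ (k + 2)) \<le> 2 * (real k + 2) * (x ^ (k + 1) + (1 - x) ^ (k + 1))"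
    using 1 2 by (intro mult_mono add_mono) auto
  then show "0 \<le> T k" by (simp add: T_def)
  show "T k \<le> 2 * (real k + 2) * (x ^ (k + 1) + (1 - x) ^ (k + 1))"
    using 2 by (simp add: T_def del: power_Suc)
qed

lemma mean_square_le:
  assumes "0 < x" "x < 1" "0 < k"
  shows "mean_square k x \<le> 1 / (real k)\<^sup>2"
proof -
  have "mean_square k x \<le> 1 / ((real k + 1) * (real k + 2))"
    using mean_square_eq[OF assms(1,2), of k] by simp
  also have "\<dots> \<le> 1 / (real k)\<^sup>2"
    using assms(3) by (intro frac_le) (auto simp: power2_eq_square algebra_simps)
  finally show ?thesis .
qed

text \<open>Away from the boundary \<open>x ^ (k + 1)\<close> and \<open>(1 - x) ^ (k + 1)\<close> are at most \<open>1 / k ^ 4\<close>, so the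
  moments are those of a cell that never meets \<open>0\<close> or \<open>1\<close>, up to a negligible error.\<close>

lemma interior_moments:
  assumes x: "0 < x" "x < 1" and k: "27 \<le> k"
    and X: "x ^ (k + 1) \<le> 1 / real k ^ 4" and Y: "(1 - x) ^ (k + 1) \<le> 1 / real k ^ 4"
  shows "\<bar>mean_offset k x\<bar> \<le> 1 / 1458 * (1 / real k ^ 3)"
    and "\<bar>mean_square k x - 1 / (real k)\<^sup>2\<bar> \<le> 302 / 100 * (1 / real k ^ 3)"
proof -
  define n where "n = real k"
  have n: "27 \<le> n" "0 < n" using k by (auto simp: n_def)
  have n2: "27 * 27 \<le> n * n" using n by (intro mult_mono) auto
  have "0 \<le> x ^ (k + 1)" "0 \<le> (1 - x) ^ (k + 1)" using x by simp_all
  then have "\<bar>(1 - x) ^ (k + 1) - x ^ (k + 1)\<bar> \<le> 1 / n ^ 4" using X Y unfolding n_def by linarith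
  then have "\<bar>mean_offset k x\<bar> \<le> (1 / n ^ 4) / (2 * (n + 1))"
    unfolding mean_offset_def n_def[symmetric] abs_divide using n by (intro frac_le) auto
  also have "\<dots> = 1 / (2 * (n + 1) * n * n ^ 3)" by (simp add: power_numeral_reduce)
  also have "\<dots> \<le> 1 / (1458 * n ^ 3)"
  proof (intro divide_left_mono mult_right_mono)
    show "1458 \<le> 2 * (n + 1) * n" using n2 n by (simp add: algebra_simps)
  qed (use n in auto)
  finally show "\<bar>mean_offset k x\<bar> \<le> 1 / 1458 * (1 / real k ^ 3)" by (simp add: n_def)
  note ms = mean_square_eq[OF x, of k, folded n_def]
  define T where "T = 2 * (n + 2) * (x ^ (k + 1) + (1 - x) ^ (k + 1)) - (2 * n + 3) * (x ^ (k + 2) + (1 - x) ^ (k + 2))"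
  have T: "0 \<le> T" "T \<le> 2 * (n + 2) * (1 / n ^ 4 + 1 / n ^ 4)"
  proof -
    show "0 \<le> T" using ms(2) by (simp add: T_def)
    have "T \<le> 2 * (n + 2) * (x ^ (k + 1) + (1 - x) ^ (k + 1))" using ms(3) by (simp add: T_def)
    also have "\<dots> \<le> 2 * (n + 2) * (1 / n ^ 4 + 1 / n ^ 4)"
      using X Y n unfolding n_def[symmetric] by (intro mult_left_mono add_mono) auto
    finally show "T \<le> 2 * (n + 2) * (1 / n ^ 4 + 1 / n ^ 4)" .
  qed
  have "T / (3 * (n + 1) * (n + 2)) \<le> (2 * (n + 2) * (1 / n ^ 4 + 1 / n ^ 4)) / (3 * (n + 1) * (n + 2))"
    using T n by (intro divide_right_mono) auto
  also have "\<dots> = (n + 2) * (4 / n ^ 4) / ((n + 2) * (3 * (n + 1)))"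
    by (simp add: algebra_simps)
  also have "\<dots> = (4 / n ^ 4) / (3 * (n + 1))"
    using n by (intro mult_divide_mult_cancel_left) auto
  also have "\<dots> = 4 / (3 * (n + 1) * n * n ^ 3)" by (simp add: power_numeral_reduce)
  also have "\<dots> \<le> 4 / (200 * n ^ 3)"
  proof (intro divide_left_mono mult_right_mono)
    show "200 \<le> 3 * (n + 1) * n" using n2 n by (simp add: algebra_simps)
  qed (use n in auto)
  finally have 1: "T / (3 * (n + 1) * (n + 2)) \<le> 2 / 100 * (1 / n ^ 3)" by simp
  have 0: "0 \<le> T / (3 * (n + 1) * (n + 2))" using T n by simp
  have 2: "1 / n\<^sup>2 - 1 / ((n + 1) * (n + 2)) \<le> 3 * (1 / n ^ 3)" "0 \<le> 1 / n\<^sup>2 - 1 / ((n + 1) * (n + 2))"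
  proof -
    have "1 / n\<^sup>2 - 1 / ((n + 1) * (n + 2)) = (3 * n + 2) / (n\<^sup>2 * ((n + 1) * (n + 2)))"
    proof -
      have nz: "n\<^sup>2 \<noteq> 0" "(n + 1) * (n + 2) \<noteq> 0" using n by auto
      show ?thesis unfolding diff_frac_eq[OF nz] by (simp add: algebra_simps power2_eq_square)
    qed
    also have "\<dots> \<le> 3 / n ^ 3"
    proof -
      have "(3 * n + 2) * n ^ 3 \<le> 3 * (n\<^sup>2 * ((n + 1) * (n + 2)))"
        using n by (simp add: algebra_simps power2_eq_square power3_eq_cube)
      then show ?thesis using n by (simp add: divide_le_eq pos_le_divide_eq mult.commute)
    qed
    finally show "1 / n\<^sup>2 - 1 / ((n + 1) * (n + 2)) \<le> 3 * (1 / n ^ 3)" by simp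
    show "0 \<le> 1 / n\<^sup>2 - 1 / ((n + 1) * (n + 2))"
      using n by (simp add: frac_le power2_eq_square mult_mono)
  qed
  have "mean_square k x - 1 / n\<^sup>2 = - ((1 / n\<^sup>2 - 1 / ((n + 1) * (n + 2))) + T / (3 * (n + 1) * (n + 2)))"
    using ms(1) by (simp add: T_def)
  then show "\<bar>mean_square k x - 1 / (real k)\<^sup>2\<bar> \<le> 302 / 100 * (1 / real k ^ 3)"
    unfolding n_def[symmetric] using 0 1 2 by linarith
qed

lemma abs_square_diff_le:
  fixes d q :: real
  assumes "\<bar>d - q\<bar> \<le> \<alpha>" "\<bar>d + q\<bar> \<le> \<beta>"
  shows "\<bar>d\<^sup>2 - q\<^sup>2\<bar> \<le> \<alpha> * \<beta>"
proof -
  have "d\<^sup>2 - q\<^sup>2 = (d - q) * (d + q)" by (simp add: power2_eq_square algebra_simps)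
  then show ?thesis using assms by (simp add: abs_mult mult_mono)
qed

text \<open>Here \<open>\<Delta>\<close> is the expected deviation, \<open>a\<close> and \<open>b\<close> are the first and second derivative, and \<open>q\<close>
  in the proof is the main term \<open>b / (2 * n\<^sup>2)\<close>; \<open>n \<ge> 27\<close> bounds \<open>1 / n ^ 3\<close> by \<open>1 / (27 * n\<^sup>2)\<close>.\<close>

lemma square_estimate_interior:
  fixes n a b c \<Delta> mo ms :: real
  assumes n: "27 \<le> n" and c: "0 < c"
    and mo: "\<bar>mo\<bar> \<le> 1 / 1458 * (1 / n ^ 3)" and ms: "\<bar>ms - 1 / n\<^sup>2\<bar> \<le> 302 / 100 * (1 / n ^ 3)"
    and \<Delta>: "\<bar>\<Delta> - a * mo - b / 2 * ms\<bar> \<le> 3 * c * (1 / n ^ 3)"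
  shows "\<bar>\<Delta>\<^sup>2 - b\<^sup>2 / (4 * n ^ 4)\<bar> \<le> (3 * c + 1 / 27\<^sup>2 * \<bar>a\<bar> + 2 * \<bar>b\<bar>)\<^sup>2 / n ^ 5"
proof -
  define v where "v = 1 / n ^ 3"
  define u where "u = 1 / n\<^sup>2"
  have v: "0 < v" "0 < u" "27 * v \<le> u" using n by (auto simp: v_def u_def field_simps power2_eq_square power3_eq_cube)
  define q where "q = b * u / 2"
  define e where "e = 1 / 1458 * \<bar>a\<bar> + 151 / 100 * \<bar>b\<bar> + 3 * c"
  define M where "M = 3 * c + 1 / 27\<^sup>2 * \<bar>a\<bar> + 2 * \<bar>b\<bar>"
  have e: "0 \<le> e" "e \<le> M" using c by (auto simp: e_def M_def)
  have "\<bar>a * mo\<bar> \<le> \<bar>a\<bar> * (1 / 1458 * v)" using mult_left_mono[OF mo, of "\<bar>a\<bar>"] by (simp add: abs_mult v_def)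
  moreover have "\<bar>b / 2 * (ms - u)\<bar> \<le> \<bar>b\<bar> / 2 * (302 / 100 * v)"
    using ms unfolding v_def[symmetric] u_def[symmetric] abs_mult by (intro mult_mono) auto
  moreover have "\<Delta> - q = (\<Delta> - a * mo - b / 2 * ms) + a * mo + b / 2 * (ms - u)"
    by (simp add: q_def right_diff_distrib)
  ultimately have "\<bar>\<Delta> - q\<bar> \<le> 3 * c * v + \<bar>a\<bar> * (1 / 1458 * v) + \<bar>b\<bar> / 2 * (302 / 100 * v)"
    using \<Delta> unfolding v_def[symmetric] by linarith
  also have "\<dots> = e * v" by (simp add: e_def algebra_simps)
  finally have 1: "\<bar>\<Delta> - q\<bar> \<le> e * v" .
  have "\<bar>\<Delta> + q\<bar> \<le> \<bar>\<Delta> - q\<bar> + \<bar>b\<bar> * u"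
  proof -
    have "\<bar>2 * q\<bar> = \<bar>b\<bar> * u" using v by (simp add: q_def abs_mult)
    then show ?thesis by linarith
  qed
  also have "\<dots> \<le> e * (u / 27) + \<bar>b\<bar> * u"
    using 1 mult_left_mono[of v "u / 27" e] e v by linarith
  also have "\<dots> = (e / 27 + \<bar>b\<bar>) * u" by (simp add: algebra_simps)
  also have "\<dots> \<le> M * u" using v c by (intro mult_right_mono) (auto simp: e_def M_def)
  finally have 2: "\<bar>\<Delta> + q\<bar> \<le> M * u" .
  have "\<bar>\<Delta> - q\<bar> \<le> M * v" using 1 mult_right_mono[of e M v] e v by linarith
  from abs_square_diff_le[OF this 2] have "\<bar>\<Delta>\<^sup>2 - q\<^sup>2\<bar> \<le> M\<^sup>2 * (u * v)" by (simp add: power2_eq_square mult_ac)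
  moreover have "u * v = 1 / n ^ 5" by (simp add: u_def v_def power_add[symmetric])
  moreover have "q\<^sup>2 = b\<^sup>2 / (4 * n ^ 4)"
    by (simp add: q_def u_def power_mult_distrib power_divide)
  ultimately show ?thesis by (simp add: M_def)
qed

text \<open>The main term is now \<open>q = a * g / (2 * n)\<close>. The coefficient of \<open>a\<^sup>2\<close> on the right leaves no
  slack, so \<open>\<bar>\<Delta> + q\<bar>\<close> is bounded through \<open>\<bar>a * mo\<bar> + \<bar>q\<bar> \<le> \<bar>a\<bar> / n\<close> and not through
  \<open>\<bar>\<Delta> - q\<bar> + 2 * \<bar>q\<bar>\<close>.\<close>

lemma square_estimate_boundary:
  fixes n a b c \<Delta> mo ms g :: real
  assumes n: "27 \<le> n" and c: "0 < c" and g: "\<bar>g\<bar> \<le> 1"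
    and mo: "\<bar>mo\<bar> \<le> 1 / (2 * n)" "\<bar>mo - g / (2 * n)\<bar> \<le> 1 / (2 * n\<^sup>2)"
    and ms: "0 \<le> ms" "ms \<le> 1 / n\<^sup>2"
    and \<Delta>: "\<bar>\<Delta> - a * mo - b / 2 * ms\<bar> \<le> 3 * c * (1 / n ^ 3)"
  shows "\<bar>\<Delta>\<^sup>2 - a\<^sup>2 * g\<^sup>2 / (4 * n\<^sup>2)\<bar> \<le> (c + \<bar>a\<bar> + \<bar>b\<bar>)\<^sup>2 / (2 * n ^ 3)"
proof -
  define u where "u = 1 / n\<^sup>2"
  define w where "w = 1 / n"
  have uw: "0 < w" "0 < u" "27 * u \<le> w" "27 * (1 / n ^ 3) \<le> u"
    using n by (auto simp: w_def u_def field_simps power2_eq_square power3_eq_cube)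
  define q where "q = a * g * w / 2"
  define r where "r = \<bar>b\<bar> / 2 + c / 9"
  have "\<bar>b / 2 * ms\<bar> \<le> \<bar>b\<bar> / 2 * u" using ms unfolding abs_mult u_def by (intro mult_mono) auto
  moreover have "3 * c * (1 / n ^ 3) \<le> c / 9 * u" using mult_left_mono[OF uw(4), of "c / 9"] c by simp
  ultimately have R: "\<bar>\<Delta> - a * mo\<bar> \<le> r * u" using \<Delta> unfolding r_def distrib_right by linarith
  have "\<bar>a * (mo - g * w / 2)\<bar> \<le> \<bar>a\<bar> * (u / 2)"
    using mo(2) unfolding abs_mult by (intro mult_left_mono) (auto simp: w_def u_def)
  moreover have "\<Delta> - q = (\<Delta> - a * mo) + a * (mo - g * w / 2)" by (simp add: q_def algebra_simps)
  ultimately have 1: "\<bar>\<Delta> - q\<bar> \<le> (\<bar>a\<bar> / 2 + r) * u" using R unfolding distrib_right by linarith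
  have "\<bar>a * mo\<bar> \<le> \<bar>a\<bar> * (w / 2)" using mo(1) unfolding abs_mult by (intro mult_left_mono) (auto simp: w_def)
  moreover have "\<bar>q\<bar> \<le> \<bar>a\<bar> * (w / 2)"
    using g uw mult_left_mono[of "\<bar>g\<bar>" 1 "\<bar>a\<bar> * w / 2"] by (simp add: q_def abs_mult mult_ac)
  ultimately have "\<bar>\<Delta> + q\<bar> \<le> r * u + \<bar>a\<bar> * w" using R by linarith
  also have "\<dots> \<le> r * (w / 27) + \<bar>a\<bar> * w"
    using uw c by (intro add_right_mono mult_left_mono) (auto simp: r_def)
  finally have 2: "\<bar>\<Delta> + q\<bar> \<le> (\<bar>a\<bar> + r / 27) * w" by (simp add: algebra_simps)
  have "\<bar>\<Delta>\<^sup>2 - q\<^sup>2\<bar> \<le> ((\<bar>a\<bar> / 2 + r) * (\<bar>a\<bar> + r / 27)) * (u * w)"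
    using abs_square_diff_le[OF 1 2] by (simp add: mult_ac)
  also have "\<dots> \<le> ((c + \<bar>a\<bar> + \<bar>b\<bar>)\<^sup>2 / 2) * (u * w)"
  proof (rule mult_right_mono)
    define A B where "A = \<bar>a\<bar>" and "B = \<bar>b\<bar>"
    have "(c + A + B)\<^sup>2 / 2 - (A / 2 + (B / 2 + c / 9)) * (A + (B / 2 + c / 9) / 27) =
        53 / 108 * (A * B) + 431 / 486 * (A * c) + 53 / 108 * (B * B) + 242 / 243 * (B * c) + 2185 / 4374 * (c * c)"
      by (simp add: power2_eq_square field_simps)
    moreover have "0 \<le> A * B" "0 \<le> A * c" "0 \<le> B * B" "0 \<le> B * c" "0 \<le> c * c"
      using c by (auto simp: A_def B_def)
    ultimately have "(A / 2 + (B / 2 + c / 9)) * (A + (B / 2 + c / 9) / 27) \<le> (c + A + B)\<^sup>2 / 2"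
      by linarith
    then show "(\<bar>a\<bar> / 2 + r) * (\<bar>a\<bar> + r / 27) \<le> (c + \<bar>a\<bar> + \<bar>b\<bar>)\<^sup>2 / 2"
      by (simp add: r_def A_def B_def)
  qed (use uw in simp)
  also have "u * w = 1 / n ^ 3" by (simp add: u_def w_def power_add[symmetric] power2_eq_square power3_eq_cube)
  also have "q\<^sup>2 = a\<^sup>2 * g\<^sup>2 / (4 * n\<^sup>2)" by (simp add: q_def w_def power_mult_distrib power_divide)
  finally show ?thesis by simp
qed

lemma power_tail_le:
  fixes y :: real
  assumes "0 < k" "0 \<le> y" "y \<le> 1 - 4 * ln (real k) / real k" "k \<le> m"
  shows "y ^ m \<le> 1 / real k ^ 4"
proof -
  let ?\<epsilon> = "4 * ln (real k) / real k"
  have e: "0 \<le> ?\<epsilon>" using assms(1) by simp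
  have "y \<le> 1" using assms(3) e by linarith
  then have "y ^ m \<le> y ^ k" using assms by (intro power_decreasing) auto
  also have "\<dots> \<le> exp (- ?\<epsilon>) ^ k"
    using assms exp_ge_add_one_self[of "- ?\<epsilon>"] by (intro power_mono) auto
  also have "\<dots> = exp (real k * (- ?\<epsilon>))" by (rule exp_of_nat_mult[symmetric])
  also have "real k * (- ?\<epsilon>) = - (4 * ln (real k))" using assms(1) by simp
  also have "exp (- (4 * ln (real k))) = 1 / exp (real 4 * ln (real k))" by (simp add: exp_minus field_simps)
  also have "exp (real 4 * ln (real k)) = real k ^ 4"
    using assms(1) by (subst exp_of_nat_mult) simp
  finally show ?thesis .
qed

context taylor_bounded
begin

lemma bias_inf_eq: "bias_inf (purf k) s x = ((LINT U|purf k. cell_average s U x) - s x)\<^sup>2"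
  by (simp add: bias_inf_def power2_commute)

lemma expected_deviation':
  assumes "0 < x" "x < 1" "0 < k"
  shows "\<bar>((LINT U|purf k. cell_average s U x) - s x) - s' x * mean_offset k x - s'' x / 2 * mean_square k x\<bar>
    \<le> 3 * C * (1 / real k ^ 3)"
proof -
  have "3 * C / ((real k + 1) * (real k + 2) * (real k + 3)) \<le> 3 * C / real k ^ 3"
    unfolding power3_eq_cube using C_pos assms by (intro divide_left_mono mult_mono) auto
  with expected_deviation[OF assms(1,2), of k] show ?thesis by simp
qed

lemma interior_bias:
  assumes k: "27 \<le> k" and x: "x \<in> {4 * ln (real k) / real k..1 - 4 * ln (real k) / real k}"
  shows "\<bar>bias_inf (purf k) s x - (s'' x)\<^sup>2 / (4 * real k ^ 4)\<bar>
    \<le> (3 * C + 1 / 27\<^sup>2 * \<bar>s' x\<bar> + 2 * \<bar>s'' x\<bar>)\<^sup>2 / real k ^ 5"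
proof -
  have "0 < 4 * ln (real k) / real k" using k by simp
  then have x01: "0 < x" "x < 1" using x by auto
  have X: "x ^ (k + 1) \<le> 1 / real k ^ 4" "(1 - x) ^ (k + 1) \<le> 1 / real k ^ 4"
    using x x01 k by (intro power_tail_le; simp)+
  show ?thesis unfolding bias_inf_eq
    by (rule square_estimate_interior[OF _ C_pos interior_moments[OF x01 k X] expected_deviation'[OF x01]]) (use k in auto)
qed

lemma boundary_bias:
  assumes k: "27 \<le> k" and x: "0 < x" "x < 1"
  shows "\<bar>bias_inf (purf k) s x - (s' x)\<^sup>2 * (x ^ (k + 1) - (1 - x) ^ (k + 1))\<^sup>2 / (4 * (real k)\<^sup>2)\<bar>
    \<le> (C + \<bar>s' x\<bar> + \<bar>s'' x\<bar>)\<^sup>2 / (2 * real k ^ 3)"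
proof -
  have g: "\<bar>(1 - x) ^ (k + 1) - x ^ (k + 1)\<bar> \<le> 1"
  proof -
    have "0 \<le> x ^ (k + 1)" "x ^ (k + 1) \<le> 1" "0 \<le> (1 - x) ^ (k + 1)" "(1 - x) ^ (k + 1) \<le> 1"
      using x by (auto intro!: power_le_one zero_le_power simp del: power_Suc)
    then show ?thesis by linarith
  qed
  have k0: "0 < k" using k by simp
  show ?thesis unfolding bias_inf_eq power2_commute[of "x ^ (k + 1)"]
    by (rule square_estimate_boundary[OF _ C_pos g mean_offset_bounds[OF x k0] mean_square_nonneg[OF x]
          mean_square_le[OF x k0] expected_deviation'[OF x k0]]) (use k in auto)
qed

end

section \<open>Regularity of the derivatives and integrability of the bias\<close>

context taylor_bounded
begin

lemma abs_le_sup_norm01: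
  assumes "x \<in> {0..<1}"
  shows "\<bar>s' x\<bar> \<le> sup_norm01 s'" "\<bar>s'' x\<bar> \<le> sup_norm01 s''"
proof -
  obtain K where K: "\<forall>x\<in>{0..<1}. \<bar>s' x\<bar> \<le> K \<and> \<bar>s'' x\<bar> \<le> K" using derivatives_bounded by blast
  have "bdd_above ((\<lambda>x. \<bar>s' x\<bar>) ` {0..<1})" "bdd_above ((\<lambda>x. \<bar>s'' x\<bar>) ` {0..<1})"
    using K by (auto intro!: bdd_aboveI2[where M=K])
  then show "\<bar>s' x\<bar> \<le> sup_norm01 s'" "\<bar>s'' x\<bar> \<le> sup_norm01 s''"
    unfolding sup_norm01_def using assms by (auto intro: cSUP_upper)
qed

lemma s'_Lipschitz:
  assumes "x \<in> {0..<1}" "y \<in> {0..<1}"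
  shows "\<bar>s' x - s' y\<bar> \<le> sup_norm01 s'' * \<bar>x - y\<bar>"
proof -
  have "norm (s' x - s' y) \<le> sup_norm01 s'' * norm (x - y)"
    by (rule field_differentiable_bound[of "{0..<1}" s' s'']) (use DERIV_s' abs_le_sup_norm01 assms in auto)
  then show ?thesis by simp
qed

text \<open>A Lipschitz function on \<open>[0, 1)\<close> has a limit at \<open>1\<close>, which inherits the bounds.\<close>

lemma s'_at_left_1:
  shows "\<bar>Lim (at_left 1) s'\<bar> \<le> sup_norm01 s'"
    and "x \<in> {0..<1} \<Longrightarrow> \<bar>s' x - Lim (at_left 1) s'\<bar> \<le> sup_norm01 s'' * (1 - x)"
proof -
  have nn: "0 \<le> sup_norm01 s''" using abs_le_sup_norm01(2)[of 0] by simp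
  have "(sup_norm01 s'')-lipschitz_on {0..<1} s'"
    using s'_Lipschitz nn by (auto simp: lipschitz_on_def dist_real_def)
  then have "uniformly_continuous_on {0..<1} s'" by (rule lipschitz_on_uniformly_continuous)
  moreover have "(1::real) \<in> closure {0..<1}" by simp
  ultimately obtain l where "(s' \<longlongrightarrow> l) (at 1 within {0..<1})"
    by (rule uniformly_continuous_on_extension_at_closure)
  moreover have "at 1 within {0..<1} = at_left (1::real)"
    by (rule at_within_nhd[of _ "{0<..<2}"]) auto
  ultimately have l: "(s' \<longlongrightarrow> l) (at_left 1)" by simp
  then have Lim: "Lim (at_left 1) s' = l" by (intro tendsto_Lim) simp
  have ev: "\<forall>\<^sub>F y in at_left (1::real). y \<in> {0..<1}"
    using eventually_at_left_real[of 0 "1::real"] by (auto elim: eventually_mono)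
  show "\<bar>Lim (at_left 1) s'\<bar> \<le> sup_norm01 s'" unfolding Lim
    by (rule tendsto_upperbound[OF tendsto_rabs[OF l]]) (use ev abs_le_sup_norm01(1) in \<open>auto elim!: eventually_mono\<close>)
  show "\<bar>s' x - Lim (at_left 1) s'\<bar> \<le> sup_norm01 s'' * (1 - x)" if x: "x \<in> {0..<1}" unfolding Lim
  proof (rule tendsto_upperbound[of "\<lambda>y. \<bar>s' x - s' y\<bar> - sup_norm01 s'' * \<bar>x - y\<bar> + sup_norm01 s'' * (1 - x)" _ "at_left 1"])
    have "((\<lambda>y. \<bar>s' x - s' y\<bar> - sup_norm01 s'' * \<bar>x - y\<bar> + sup_norm01 s'' * (1 - x)) \<longlongrightarrow>
       \<bar>s' x - l\<bar> - sup_norm01 s'' * \<bar>x - 1\<bar> + sup_norm01 s'' * (1 - x)) (at_left 1)"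
      by (intro tendsto_intros l)
    then show "((\<lambda>y. \<bar>s' x - s' y\<bar> - sup_norm01 s'' * \<bar>x - y\<bar> + sup_norm01 s'' * (1 - x)) \<longlongrightarrow> \<bar>s' x - l\<bar>) (at_left 1)"
      using x by simp
    show "\<forall>\<^sub>F y in at_left 1. \<bar>s' x - s' y\<bar> - sup_norm01 s'' * \<bar>x - y\<bar> + sup_norm01 s'' * (1 - x) \<le> sup_norm01 s'' * (1 - x)"
      using ev s'_Lipschitz[OF x] by (auto elim!: eventually_mono)
  qed simp
qed

lemma borel_measurable_s':
  "(\<lambda>x. indicator {0..<1} x * s' x) \<in> borel_measurable borel"
proof -
  have "continuous_on {0..<1} s'"
    by (auto simp: continuous_on_eq_continuous_within intro!: DERIV_continuous[OF DERIV_s'])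
  then show ?thesis using borel_measurable_continuous_on_indicator[of "{0..<1}" s'] by simp
qed

text \<open>The second derivative is a pointwise limit of difference quotients. The step \<open>(1 - x) / (i + 2)\<close>
  keeps the second node inside \<open>[0, 1)\<close>.\<close>

lemma borel_measurable_s'':
  "(\<lambda>x. indicator {0..<1} x * s'' x) \<in> borel_measurable borel"
proof (rule borel_measurable_LIMSEQ_real)
  define h where "h i x = (1 - x) / real (i + 2)" for i x
  define g where "g x = indicator {0..<1} x * s' x" for x
  define q where "q i x = indicator {0..<1} x * ((g (x + h i x) - g x) / h i x)" for i x
  have [measurable]: "g \<in> borel_measurable borel" unfolding g_def by (rule borel_measurable_s')
  show "q i \<in> borel_measurable borel" for i unfolding q_def h_def by measurable
  fix x :: real
  show "(\<lambda>i. q i x) \<longlonglongrightarrow> indicator {0..<1} x * s'' x"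
  proof (cases "x \<in> {0..<1}")
    case True
    have h: "0 < h i x" "h i x < 1 - x" for i using True by (auto simp: h_def divide_less_eq)
    have "(\<lambda>i. x + h i x) \<longlonglongrightarrow> x + 0"
      unfolding h_def by (intro tendsto_intros real_tendsto_divide_at_top[OF tendsto_const] filterlim_compose[OF filterlim_real_sequentially] filterlim_add_const_nat_at_top)
    then have "filterlim (\<lambda>i. x + h i x) (at x within {0..<1}) sequentially"
    proof -
      have "x + h i x \<in> {0..<1} \<and> x + h i x \<noteq> x" for i using True h[of i] by auto
      with \<open>(\<lambda>i. x + h i x) \<longlonglongrightarrow> x + 0\<close> show ?thesis unfolding filterlim_at by simp
    qed
    moreover have "((\<lambda>y. (s' y - s' x) / (y - x)) \<longlongrightarrow> s'' x) (at x within {0..<1})"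
      using DERIV_s'[OF True] by (simp add: has_field_derivative_iff)
    ultimately have "(\<lambda>i. (s' (x + h i x) - s' x) / (x + h i x - x)) \<longlonglongrightarrow> s'' x"
      by (rule filterlim_compose[rotated])
    moreover have "q i x = (s' (x + h i x) - s' x) / (x + h i x - x)" for i
    proof -
      have "x + h i x \<in> {0..<1}" using True h[of i] by auto
      then show ?thesis using True by (simp add: q_def g_def)
    qed
    ultimately show ?thesis using True by simp
  qed (simp add: q_def)
qed

text \<open>Almost surely the cell average at \<open>x\<close> is a difference quotient of the primitive \<open>S\<close> of \<open>s\<close>, and
  this expression is jointly measurable in \<open>x\<close> and \<open>\<xi>\<close>.\<close>

lemma borel_measurable_bias_inf:
  "(\<lambda>x. indicator {0..<1} x * bias_inf (purf k) s x) \<in> borel_measurable borel"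
proof -
  interpret prob_space "unifs k" by (rule prob_space_unifs)
  define S where "S t = (LINT u:{0..<t}|lborel. indicator {0..<1} u * s u)" for t :: real
  have [measurable]: "S \<in> borel_measurable borel"
    unfolding S_def by (rule borel_measurable_set_integral_mono(2)) (auto simp: mono_def)
  define h where "h x \<xi> = (S (right_end k \<xi> x) - S (left_end k \<xi> x)) / (right_end k \<xi> x - left_end k \<xi> x)" for x \<xi>
  have [measurable]: "(\<lambda>(x, \<xi>). h x \<xi>) \<in> borel_measurable (borel \<Otimes>\<^sub>M unifs k)"
    unfolding h_def by measurable
  have [measurable]: "(\<lambda>x. LINT \<xi>|unifs k. h x \<xi>) \<in> borel_measurable borel"
    by measurable
  have "continuous_on {0..<1} s"
    by (auto simp: continuous_on_eq_continuous_within intro!: DERIV_continuous[OF DERIV_s])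
  then have [measurable]: "(\<lambda>x. indicator {0..<1} x * s x) \<in> borel_measurable borel"
    using borel_measurable_continuous_on_indicator[of "{0..<1}" s] by simp
  have eq: "(LINT U|purf k. cell_average s U x) = (LINT \<xi>|unifs k. h x \<xi>)" if x: "x \<in> {0..<1}" for x
  proof -
    have x': "0 \<le> x" "x < 1" using x by auto
    have Aeq: "cell_average s (purf_partition k \<xi>) x = 1 / measure lborel {left_end k \<xi> x..<right_end k \<xi> x} *
        (LINT t:{left_end k \<xi> x..<right_end k \<xi> x}|lborel. s t)" for \<xi> :: "nat \<Rightarrow> real"
      using x' unfolding cell_average_def by (subst (1 2) partition_cell_purf_partition) auto
    have [measurable]: "(\<lambda>\<xi>. cell_average s (purf_partition k \<xi>) x) \<in> borel_measurable (unifs k)"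
      unfolding Aeq by (rule borel_measurable_average_around) (use left_end_le[of x k] right_end_gt[of x k] x' in auto)
    have "AE \<xi> in unifs k. cell_average s (purf_partition k \<xi>) x = h x \<xi>"
      using AE_unifs
    proof eventually_elim
      fix \<xi> :: "nat \<Rightarrow> real" assume \<xi>: "\<forall>i<k. 0 \<le> \<xi> i \<and> \<xi> i < 1"
      define l r where "l = left_end k \<xi> x" and "r = right_end k \<xi> x"
      have lr: "0 \<le> l" "l \<le> x" "x < r" "r \<le> 1" unfolding l_def r_def
        using left_end_mem[of k \<xi> x] right_end_mem[of k \<xi> x] \<xi> left_end_le[of x k \<xi>] right_end_gt[of x k \<xi>] x'
        by (force simp: less_imp_le)+
      have i: "set_integrable lborel A (\<lambda>u. indicator {0..<1} u * s u)" if "A \<subseteq> {0..<1}" "A \<in> sets lborel" for A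
        using set_integrable_subset[OF set_integrable_s that(2,1)] that(1)
        by (subst set_integrable_cong[OF refl refl, where f'=s]) auto
      have "S r = (LINT u:{0..<l} \<union> {l..<r}|lborel. indicator {0..<1} u * s u)"
        unfolding S_def using lr by (intro arg_cong[where f="\<lambda>A. set_lebesgue_integral _ A _"]) auto
      also have "\<dots> = S l + (LINT u:{l..<r}|lborel. indicator {0..<1} u * s u)"
        unfolding S_def using lr by (intro set_integral_Un i) auto
      also have "(LINT u:{l..<r}|lborel. indicator {0..<1} u * s u) = (LINT u:{l..<r}|lborel. s u)"
        using lr by (intro set_lebesgue_integral_cong) auto
      finally show "cell_average s (purf_partition k \<xi>) x = h x \<xi>"
        using lr unfolding Aeq h_def l_def[symmetric] r_def[symmetric] by simp
    qed
    moreover have "h x \<in> borel_measurable (unifs k)" by measurable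
    ultimately show ?thesis
      unfolding integral_purf_cell_average[OF x'] by (intro integral_cong_AE) auto
  qed
  have "(\<lambda>x. indicator {0..<1} x * bias_inf (purf k) s x) =
      (\<lambda>x. indicator {0..<1} x * (indicator {0..<1} x * s x - (LINT \<xi>|unifs k. h x \<xi>))\<^sup>2)"
    using eq by (auto simp: bias_inf_def fun_eq_iff split: split_indicator)
  also have "\<dots> \<in> borel_measurable borel" by measurable
  finally show ?thesis .
qed

lemma set_integrable_bias_inf:
  assumes k: "27 \<le> k" and A: "A \<in> sets lborel" "A \<subseteq> {0<..<1}"
  shows "set_integrable lborel A (bias_inf (purf k) s)"
proof (rule set_integrable_subset[OF _ A])
  define P Q where "P = sup_norm01 s'" and "Q = sup_norm01 s''"
  show "set_integrable lborel {0<..<1} (bias_inf (purf k) s)" unfolding set_integrable_def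
  proof (rule integrableI_bounded_set[where A="{0<..<1}" and B="(C + P + Q)\<^sup>2 / (2 * real k ^ 3) + P\<^sup>2"])
    have "(\<lambda>x. indicator {0<..<1} x * (indicator {0..<1} x * bias_inf (purf k) s x)) \<in> borel_measurable borel"
      by (rule borel_measurable_times[OF _ borel_measurable_bias_inf]) simp
    moreover have "(\<lambda>x. indicator {0<..<1} x * (indicator {0..<1} x * bias_inf (purf k) s x)) =
        (\<lambda>x. indicator {0<..<1} x *\<^sub>R bias_inf (purf k) s x)"
      by (auto simp: fun_eq_iff split: split_indicator)
    ultimately show "(\<lambda>x. indicator {0<..<1} x *\<^sub>R bias_inf (purf k) s x) \<in> borel_measurable lborel"
      by simp
    have "norm (indicator {0<..<1} x *\<^sub>R bias_inf (purf k) s x) \<le> (C + P + Q)\<^sup>2 / (2 * real k ^ 3) + P\<^sup>2"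
      if x: "x \<in> {0<..<1}" for x
    proof -
      have x': "0 < x" "x < 1" using x by auto
      have PQ: "\<bar>s' x\<bar> \<le> P" "\<bar>s'' x\<bar> \<le> Q" using abs_le_sup_norm01[of x] x by (auto simp: P_def Q_def)
      have "0 \<le> x ^ (k + 1)" "x ^ (k + 1) \<le> 1" "0 \<le> (1 - x) ^ (k + 1)" "(1 - x) ^ (k + 1) \<le> 1"
        using x by (auto intro!: power_le_one zero_le_power simp del: power_Suc)
      then have "\<bar>x ^ (k + 1) - (1 - x) ^ (k + 1)\<bar> \<le> 1" by linarith
      then have g: "(x ^ (k + 1) - (1 - x) ^ (k + 1))\<^sup>2 \<le> 1" by (rule abs_square_le_1[THEN iffD2])
      have "(s' x)\<^sup>2 \<le> P\<^sup>2" using PQ by (intro power2_le_iff_abs_le[THEN iffD2]) auto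
      moreover have "1 \<le> 4 * (real k)\<^sup>2"
      proof -
        have "1 \<le> (real k)\<^sup>2" using k by (intro one_le_power) auto
        then show ?thesis by linarith
      qed
      ultimately have 1: "(s' x)\<^sup>2 * (x ^ (k + 1) - (1 - x) ^ (k + 1))\<^sup>2 / (4 * (real k)\<^sup>2) \<le> P\<^sup>2 * 1 / 1"
        using g by (intro frac_le mult_mono) simp_all
      have "(C + \<bar>s' x\<bar> + \<bar>s'' x\<bar>)\<^sup>2 / (2 * real k ^ 3) \<le> (C + P + Q)\<^sup>2 / (2 * real k ^ 3)"
        using PQ C_pos by (intro divide_right_mono power_mono) auto
      moreover have "0 \<le> bias_inf (purf k) s x" by (simp add: bias_inf_def)
      moreover have "norm (indicator {0<..<1} x *\<^sub>R bias_inf (purf k) s x) = \<bar>bias_inf (purf k) s x\<bar>"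
        using x by simp
      ultimately show ?thesis using boundary_bias[OF k x'] 1 by linarith
    qed
    then show "AE x in lborel. x \<in> {0<..<1} \<longrightarrow>
        norm (indicator {0<..<1} x *\<^sub>R bias_inf (purf k) s x) \<le> (C + P + Q)\<^sup>2 / (2 * real k ^ 3) + P\<^sup>2"
      by (intro AE_I2) blast
  qed auto
qed

lemma set_integrable_s''_square:
  assumes A: "A \<in> sets lborel" "A \<subseteq> {0..<1}"
  shows "set_integrable lborel A (\<lambda>x. (s'' x)\<^sup>2)"
proof (rule set_integrable_subset[OF _ A])
  show "set_integrable lborel {0..<1} (\<lambda>x. (s'' x)\<^sup>2)" unfolding set_integrable_def
  proof (rule integrableI_bounded_set[where A="{0..<1}" and B="(sup_norm01 s'')\<^sup>2"])
    have "(\<lambda>x. (indicator {0..<1} x * s'' x)\<^sup>2) \<in> borel_measurable borel"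
      by (intro borel_measurable_power borel_measurable_s'')
    moreover have "(\<lambda>x. (indicator {0..<1} x * s'' x)\<^sup>2) = (\<lambda>x. indicator {0..<1} x *\<^sub>R (s'' x)\<^sup>2)"
      by (auto simp: fun_eq_iff split: split_indicator)
    ultimately show "(\<lambda>x. indicator {0..<1} x *\<^sub>R (s'' x)\<^sup>2) \<in> borel_measurable lborel" by simp
    have "norm (indicator {0..<1} x *\<^sub>R (s'' x)\<^sup>2) \<le> (sup_norm01 s'')\<^sup>2" if "x \<in> {0..<1}" for x
    proof -
      have "(s'' x)\<^sup>2 \<le> (sup_norm01 s'')\<^sup>2"
        using abs_le_sup_norm01(2)[OF that] by (intro power2_le_iff_abs_le[THEN iffD2]) auto
      then show ?thesis using that by simp
    qed
    then show "AE x in lborel. x \<in> {0..<1} \<longrightarrow> norm (indicator {0..<1} x *\<^sub>R (s'' x)\<^sup>2) \<le> (sup_norm01 s'')\<^sup>2"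
      by (intro AE_I2) blast
  qed auto
qed

end

section \<open>Integrated bias\<close>

text \<open>In the boundary layer at \<open>0\<close> the weight is essentially \<open>(1 - x) ^ (2 * k + 2)\<close> and the derivative
  \<open>q\<close> at \<open>x\<close> may be replaced by its value \<open>L\<close> at the end. The factor \<open>x\<close> in the error makes its
  integral of order \<open>1 / k\<^sup>2\<close>. Stated for general \<open>q\<close> and \<open>L\<close>, so that it also serves at \<open>1\<close>
  after reflection.\<close>

lemma boundary_weight:
  fixes x q L P Q M n :: real
  assumes x: "0 < x" "x \<le> 1 / 2" and n: "0 < n"
    and q: "\<bar>q\<bar> \<le> P" "\<bar>L\<bar> \<le> P" "\<bar>q - L\<bar> \<le> Q * x" and M: "P + Q \<le> M" "0 \<le> Q"
  shows "\<bar>q\<^sup>2 * (x ^ (k + 1) - (1 - x) ^ (k + 1))\<^sup>2 / (4 * n\<^sup>2) - L\<^sup>2 * (1 - x) ^ (2 * k + 2) / (4 * n\<^sup>2)\<bar>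
    \<le> 5 / 8 * (M\<^sup>2 / n\<^sup>2) * (x * (1 - x) ^ (2 * k + 1))"
proof -
  define w X W where "w = 1 - x" and "X = x ^ (k + 1)" and "W = w ^ (k + 1)"
  have w: "x \<le> w" "0 < w" "w \<le> 1" using x by (auto simp: w_def)
  have P: "0 \<le> P" using q(1) by linarith
  have XW: "0 \<le> X" "X \<le> W" "0 \<le> W" "X \<le> x * w ^ k"
    using x w by (auto simp: X_def W_def intro!: power_mono mult_left_mono simp del: power_Suc)
       (auto intro!: mult_mono power_mono)
  have W2: "W\<^sup>2 = w ^ (2 * k + 2)" "W * w ^ k = w ^ (2 * k + 1)"
  proof -
    have "W\<^sup>2 = w ^ ((k + 1) * 2)" "W * w ^ k = w ^ ((k + 1) + k)"
      by (simp_all only: W_def power_mult power_add)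
    then show "W\<^sup>2 = w ^ (2 * k + 2)" "W * w ^ k = w ^ (2 * k + 1)" by (simp_all add: mult_2 mult_2_right)
  qed
  have "w ^ (2 * k + 2) \<le> w ^ (2 * k + 1)" using w by (intro power_decreasing) auto
  then have g2: "(X - W)\<^sup>2 \<le> w ^ (2 * k + 1)"
    using XW power_mono[of "W - X" W 2] W2 by (simp add: power2_commute[of X])
  have "W\<^sup>2 - (X - W)\<^sup>2 = X * (2 * W - X)" by (simp add: power2_eq_square algebra_simps)
  moreover have "0 \<le> X * (2 * W - X)" using XW by simp
  moreover have "X * (2 * W - X) \<le> (x * w ^ k) * (2 * W)" using XW w x by (intro mult_mono) auto
  ultimately have d: "\<bar>(X - W)\<^sup>2 - W\<^sup>2\<bar> \<le> 2 * (x * w ^ (2 * k + 1))"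
    unfolding W2(2)[symmetric] by (simp add: mult_ac)
  have "4 * P * Q \<le> (P + Q)\<^sup>2" using zero_le_power2[of "P - Q"] by (simp add: power2_eq_square algebra_simps)
  also have "\<dots> \<le> M\<^sup>2" using M P by (intro power_mono) auto
  finally have PQ: "2 * P * Q \<le> M\<^sup>2 / 2" by simp
  have L2: "L\<^sup>2 \<le> M\<^sup>2" using q M by (intro power2_le_iff_abs_le[THEN iffD2]) auto
  have "\<bar>q + L\<bar> \<le> 2 * P" using q by linarith
  then have "\<bar>q\<^sup>2 - L\<^sup>2\<bar> \<le> (Q * x) * (2 * P)" by (rule abs_square_diff_le[OF q(3)])
  also have "\<dots> \<le> M\<^sup>2 / 2 * x" using PQ x mult_right_mono[OF PQ, of x] by (simp add: mult_ac)
  finally have qL: "\<bar>q\<^sup>2 - L\<^sup>2\<bar> \<le> M\<^sup>2 / 2 * x" .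
  have "q\<^sup>2 * (X - W)\<^sup>2 - L\<^sup>2 * W\<^sup>2 = (q\<^sup>2 - L\<^sup>2) * (X - W)\<^sup>2 + L\<^sup>2 * ((X - W)\<^sup>2 - W\<^sup>2)"
    by (simp add: algebra_simps)
  moreover have "\<bar>(q\<^sup>2 - L\<^sup>2) * (X - W)\<^sup>2\<bar> \<le> (M\<^sup>2 / 2 * x) * w ^ (2 * k + 1)"
    unfolding abs_mult using qL g2 x by (intro mult_mono) auto
  moreover have "\<bar>L\<^sup>2 * ((X - W)\<^sup>2 - W\<^sup>2)\<bar> \<le> M\<^sup>2 * (2 * (x * w ^ (2 * k + 1)))"
    unfolding abs_mult using d L2 by (intro mult_mono) auto
  ultimately have "\<bar>q\<^sup>2 * (X - W)\<^sup>2 - L\<^sup>2 * W\<^sup>2\<bar> \<le> (M\<^sup>2 / 2 * x) * w ^ (2 * k + 1) + M\<^sup>2 * (2 * (x * w ^ (2 * k + 1)))"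
    by linarith
  also have "\<dots> = 5 / 2 * M\<^sup>2 * (x * w ^ (2 * k + 1))" by (simp add: algebra_simps)
  finally have "\<bar>q\<^sup>2 * (X - W)\<^sup>2 - L\<^sup>2 * W\<^sup>2\<bar> / (4 * n\<^sup>2) \<le> (5 / 2 * M\<^sup>2 * (x * w ^ (2 * k + 1))) / (4 * n\<^sup>2)"
    by (intro divide_right_mono) auto
  moreover have "\<bar>q\<^sup>2 * (X - W)\<^sup>2 / (4 * n\<^sup>2) - L\<^sup>2 * W\<^sup>2 / (4 * n\<^sup>2)\<bar> = \<bar>q\<^sup>2 * (X - W)\<^sup>2 - L\<^sup>2 * W\<^sup>2\<bar> / (4 * n\<^sup>2)"
    by (simp add: diff_divide_distrib[symmetric] abs_divide)
  moreover have "(5 / 2 * M\<^sup>2 * (x * w ^ (2 * k + 1))) / (4 * n\<^sup>2) = 5 / 8 * (M\<^sup>2 / n\<^sup>2) * (x * w ^ (2 * k + 1))"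
    by simp
  ultimately show ?thesis unfolding W2(1) by (simp only: X_def W_def w_def)
qed

text \<open>The main term is \<open>L\<^sup>2 / (4 * k\<^sup>2)\<close> times the integral of \<open>(1 - x) ^ (2 * k + 2)\<close>, which is close to
  \<open>1 / (2 * k)\<close>. The first error term is the pointwise error multiplied by the width of the layer.\<close>

lemma boundary_integral:
  fixes B :: "real \<Rightarrow> real"
  assumes k: "27 \<le> k" and e: "0 < \<epsilon>" "\<epsilon> \<le> 1" "(1 - \<epsilon>) ^ (2 * k + 3) \<le> 1 / real k ^ 4"
    and B: "set_integrable lborel {0<..<\<epsilon>} B"
    and bnd: "\<And>x. x \<in> {0<..<\<epsilon>} \<Longrightarrow> \<bar>B x - L\<^sup>2 * (1 - x) ^ (2 * k + 2) / (4 * (real k)\<^sup>2)\<bar>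
      \<le> M\<^sup>2 / (2 * real k ^ 3) + 5 / 8 * (M\<^sup>2 / (real k)\<^sup>2) * (x * (1 - x) ^ (2 * k + 1))"
    and LM: "L\<^sup>2 \<le> M\<^sup>2"
  shows "\<bar>(LINT x:{0<..<\<epsilon>}|lborel. B x) - L\<^sup>2 / (8 * real k ^ 3)\<bar> \<le> \<epsilon> * M\<^sup>2 / (2 * real k ^ 3) + 1 / 2 * (M\<^sup>2 / real k ^ 4)"
proof -
  define n where "n = real k"
  have n: "27 \<le> n" "0 < n" using k by (auto simp: n_def)
  define \<tau> where "\<tau> = (1 - \<epsilon>) ^ (2 * k + 3)"
  have \<tau>: "0 \<le> \<tau>" "\<tau> \<le> 1 / n ^ 4" using e by (auto simp: \<tau>_def n_def)
  let ?h = "\<lambda>x. L\<^sup>2 / (4 * n\<^sup>2) * (1 - x) ^ (2 * k + 2)"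
  let ?r = "\<lambda>x::real. x * (1 - x) ^ (2 * k + 1)"
  let ?E = "\<lambda>x. M\<^sup>2 / (2 * n ^ 3) + 5 / 8 * (M\<^sup>2 / n\<^sup>2) * ?r x"
  have ic: "set_integrable lborel {0<..<c} f" if "continuous_on {0..c} f" for f :: "real \<Rightarrow> real" and c
    by (rule set_integrable_subset[OF borel_integrable_atLeastAtMost'[OF that]]) auto
  have ih: "set_integrable lborel {0<..<\<epsilon>} (\<lambda>x. (1 - x) ^ (2 * k + 2))" by (intro ic continuous_intros)
  have ir: "set_integrable lborel {0<..<c} ?r" for c by (intro ic continuous_intros)
  have i1: "set_integrable lborel {0<..<\<epsilon>} (\<lambda>x::real. M\<^sup>2 / (2 * n ^ 3))" by (intro ic continuous_intros)
  have "(LINT x:{0<..<\<epsilon>}|lborel. (1 - x) ^ (2 * k + 2)) = (1 - \<tau>) / (2 * n + 3)"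
    using integral_reflected_power0[of \<epsilon> 1 "2 * k + 2"] e set_integral_Ioo_eq_Ico(2)[OF ih]
    by (simp add: \<tau>_def n_def numeral_3_eq_3 numeral_2_eq_2 add_ac)
  then have H: "(LINT x:{0<..<\<epsilon>}|lborel. ?h x) = L\<^sup>2 / (4 * n\<^sup>2) * ((1 - \<tau>) / (2 * n + 3))"
    by (subst set_integral_mult_right) simp
  have R: "(LINT x:{0<..<\<epsilon>}|lborel. ?r x) \<le> 1 / (4 * n\<^sup>2)"
  proof -
    have "(LINT x:{0<..<\<epsilon>}|lborel. ?r x) \<le> (LINT x:{0<..<1}|lborel. ?r x)"
      unfolding set_lebesgue_integral_def using ir[of \<epsilon>] ir[of 1] e unfolding set_integrable_def
      by (intro integral_mono) (auto split: split_indicator)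
    also have "\<dots> = (LINT x:{0..<1}|lborel. ?r x)"
      by (rule set_integral_Ioo_eq_Ico(2)[OF ir, symmetric])
    also have "\<dots> = 1 / (2 * n + 2) - 1 / (2 * n + 3)"
    proof -
      have "2 * (LINT x:{0..<1}|lborel. ?r x) = 2 * (1 / (2 * n + 2) - 1 / (2 * n + 3))"
        using integral_reflected_power1[of 1 "2 * k + 1"]
        by (simp add: n_def mult.assoc add_ac del: mult_cancel_left)
      then show ?thesis by simp
    qed
    also have "\<dots> = 1 / ((2 * n + 2) * (2 * n + 3))" using n by (simp add: divide_simps)
    also have "\<dots> \<le> 1 / (4 * n\<^sup>2)" using n by (intro frac_le) (auto simp: power2_eq_square algebra_simps)
    finally show ?thesis .
  qed
  have "\<bar>(LINT x:{0<..<\<epsilon>}|lborel. B x) - (LINT x:{0<..<\<epsilon>}|lborel. ?h x)\<bar> \<le> (LINT x:{0<..<\<epsilon>}|lborel. ?E x)"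
    using bnd by (intro abs_set_integral_diff_le B set_integrable_mult_right ih set_integral_add(1) i1 ir)
      (simp_all add: n_def)
  also have "\<dots> = \<epsilon> * M\<^sup>2 / (2 * n ^ 3) + 5 / 8 * (M\<^sup>2 / n\<^sup>2) * (LINT x:{0<..<\<epsilon>}|lborel. ?r x)"
  proof -
    have i2: "set_integrable lborel {0<..<\<epsilon>} (\<lambda>x. 5 / 8 * (M\<^sup>2 / n\<^sup>2) * ?r x)"
      by (intro set_integrable_mult_right ir)
    have c: "(LINT x:{0<..<\<epsilon>}|lborel. c) = \<epsilon> * c" for c :: real
      using e by (simp add: set_lebesgue_integral_def)
    have "(LINT x:{0<..<\<epsilon>}|lborel. ?E x) = (LINT x:{0<..<\<epsilon>}|lborel. M\<^sup>2 / (2 * n ^ 3)) +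
        (LINT x:{0<..<\<epsilon>}|lborel. 5 / 8 * (M\<^sup>2 / n\<^sup>2) * ?r x)"
      by (rule set_integral_add(2)[OF i1 i2])
    then show ?thesis unfolding c by (subst (asm) set_integral_mult_right) simp
  qed
  also have "\<dots> \<le> \<epsilon> * M\<^sup>2 / (2 * n ^ 3) + 5 / 8 * (M\<^sup>2 / n\<^sup>2) * (1 / (4 * n\<^sup>2))"
    using R by (intro add_left_mono mult_left_mono) auto
  also have "\<dots> = \<epsilon> * M\<^sup>2 / (2 * n ^ 3) + 5 / 32 * (M\<^sup>2 / n ^ 4)"
    by (simp add: power_numeral_reduce)
  finally have 1: "\<bar>(LINT x:{0<..<\<epsilon>}|lborel. B x) - L\<^sup>2 / (4 * n\<^sup>2) * ((1 - \<tau>) / (2 * n + 3))\<bar>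
      \<le> \<epsilon> * M\<^sup>2 / (2 * n ^ 3) + 5 / 32 * (M\<^sup>2 / n ^ 4)" unfolding H .
  have 2: "\<bar>L\<^sup>2 / (4 * n\<^sup>2) * ((1 - \<tau>) / (2 * n + 3)) - L\<^sup>2 / (8 * n ^ 3)\<bar> \<le> 11 / 32 * (M\<^sup>2 / n ^ 4)"
  proof -
    have "1 / (2 * n) - 1 / (2 * n + 3) = 3 / (2 * n * (2 * n + 3))" using n by (simp add: divide_simps)
    also have "\<dots> \<le> 3 / (4 * n\<^sup>2)" using n by (intro frac_le) (auto simp: power2_eq_square)
    finally have a: "1 / (2 * n) - 1 / (2 * n + 3) \<le> 3 / 4 * (1 / n\<^sup>2)" by simp
    have b: "0 \<le> 1 / (2 * n) - 1 / (2 * n + 3)" using n by (simp add: frac_le)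
    have "\<tau> / (2 * n + 3) \<le> (1 / n ^ 4) / 2" using n \<tau> by (intro frac_le) auto
    also have "\<dots> \<le> 1 / 2 * (1 / n\<^sup>2)" using n by (simp add: frac_le power_increasing)
    finally have c: "\<tau> / (2 * n + 3) \<le> 1 / 2 * (1 / n\<^sup>2)" .
    have d: "0 \<le> \<tau> / (2 * n + 3)" using \<tau> n by simp
    have "\<bar>(1 - \<tau>) / (2 * n + 3) - 1 / (2 * n)\<bar> \<le> 11 / 8 * (1 / n\<^sup>2)"
      using a b c d n unfolding diff_divide_distrib[of 1 \<tau>] by linarith
    then have "L\<^sup>2 / (4 * n\<^sup>2) * \<bar>(1 - \<tau>) / (2 * n + 3) - 1 / (2 * n)\<bar> \<le> M\<^sup>2 / (4 * n\<^sup>2) * (11 / 8 * (1 / n\<^sup>2))"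
      using LM n by (intro mult_mono divide_right_mono) auto
    also have "L\<^sup>2 / (4 * n\<^sup>2) * \<bar>(1 - \<tau>) / (2 * n + 3) - 1 / (2 * n)\<bar> =
        \<bar>L\<^sup>2 / (4 * n\<^sup>2) * ((1 - \<tau>) / (2 * n + 3) - 1 / (2 * n))\<bar>" by (simp add: abs_mult)
    also have "L\<^sup>2 / (4 * n\<^sup>2) * ((1 - \<tau>) / (2 * n + 3) - 1 / (2 * n)) =
        L\<^sup>2 / (4 * n\<^sup>2) * ((1 - \<tau>) / (2 * n + 3)) - L\<^sup>2 / (8 * n ^ 3)"
      by (simp add: right_diff_distrib power_numeral_reduce)
    also have "M\<^sup>2 / (4 * n\<^sup>2) * (11 / 8 * (1 / n\<^sup>2)) = 11 / 32 * (M\<^sup>2 / n ^ 4)"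
      by (simp add: power_numeral_reduce)
    finally show ?thesis .
  qed
  show ?thesis unfolding n_def[symmetric] using 1 2 by linarith
qed

text \<open>At \<open>k = 27\<close> the left-hand side is about \<open>0.488\<close>. The bound \<open>ln 27 \<le> 27 / 8\<close> amounts to
  \<open>3 ^ 8 \<le> exp 9\<close>, and the tangent line of \<open>ln\<close> at \<open>27\<close> handles larger \<open>k\<close>.\<close>

lemma boundary_layer_width:
  fixes k :: nat
  assumes "27 \<le> k"
  shows "4 * ln (real k) / real k \<le> 1 / 2"
proof -
  have "ln (real k / 27) \<le> real k / 27 - 1" using assms by (intro ln_le_minus_one) auto
  moreover have "ln (real k / 27) = ln (real k) - ln 27" using assms by (simp add: ln_div)
  moreover have "ln (27::real) \<le> 27 / 8"
  proof -
    have e: "27 / 10 \<le> exp (1::real)" using abs_le_D2[OF e_approx_32] by simp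
    have "(3::real) ^ 8 \<le> (27 / 10) ^ 9" by (simp add: power_divide)
    also have "\<dots> \<le> exp 1 ^ 9" using e by (intro power_mono) auto
    also have "\<dots> = exp 9" by (simp flip: exp_of_nat_mult)
    finally have "ln ((3::real) ^ 8) \<le> ln (exp 9)" by (subst ln_le_cancel_iff) auto
    then have "8 * ln (3::real) \<le> 9" using ln_realpow[of "3::real" 8] by simp
    moreover have "ln (27::real) = 3 * ln 3" using ln_realpow[of "3::real" 3] by simp
    ultimately show ?thesis by simp
  qed
  ultimately have "8 * ln (real k) \<le> real k" using assms by linarith
  then show ?thesis using assms by (simp add: divide_le_eq)
qed

context taylor_bounded
begin

lemma interior_integral:
  assumes k: "27 \<le> k" and \<epsilon>: "\<epsilon> = 4 * ln (real k) / real k"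
  shows "\<bar>(LINT x:{\<epsilon>..1 - \<epsilon>}|lborel. bias_inf (purf k) s x)
        - 1 / (4 * real k ^ 4) * (LINT x:{\<epsilon>..1 - \<epsilon>}|lborel. (s'' x)\<^sup>2)\<bar>
      \<le> (3 * C + 1 / 27\<^sup>2 * sup_norm01 s' + 2 * sup_norm01 s'')\<^sup>2 / real k ^ 5"
proof -
  have e0: "0 < \<epsilon>" using k by (simp add: \<epsilon>)
  let ?A = "{\<epsilon>..1 - \<epsilon>}"
  let ?c = "(3 * C + 1 / 27\<^sup>2 * sup_norm01 s' + 2 * sup_norm01 s'')\<^sup>2 / real k ^ 5"
  have A: "?A \<subseteq> {0<..<1}" "?A \<subseteq> {0..<1}" using e0 by auto
  have "\<bar>(LINT x:?A|lborel. bias_inf (purf k) s x) - (LINT x:?A|lborel. 1 / (4 * real k ^ 4) * (s'' x)\<^sup>2)\<bar>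
    \<le> (LINT x:?A|lborel. ?c)"
  proof (intro abs_set_integral_diff_le set_integrable_bias_inf set_integrable_mult_right set_integrable_s''_square k A)
    show "set_integrable lborel ?A (\<lambda>x. ?c)" by (intro borel_integrable_atLeastAtMost' continuous_intros)
    fix x assume x: "x \<in> ?A"
    have "\<bar>s' x\<bar> \<le> sup_norm01 s'" "\<bar>s'' x\<bar> \<le> sup_norm01 s''" using abs_le_sup_norm01[of x] x A by auto
    then have "(3 * C + 1 / 27\<^sup>2 * \<bar>s' x\<bar> + 2 * \<bar>s'' x\<bar>)\<^sup>2 / real k ^ 5 \<le> ?c"
      using C_pos by (intro divide_right_mono power_mono add_mono mult_left_mono) auto
    then show "\<bar>bias_inf (purf k) s x - 1 / (4 * real k ^ 4) * (s'' x)\<^sup>2\<bar> \<le> ?c"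
      using interior_bias[OF k, of x] x by (simp add: \<epsilon>)
  qed auto
  also have "\<dots> = measure lborel ?A * ?c" by (simp add: set_lebesgue_integral_def)
  also have "\<dots> \<le> 1 * ?c" using e0 by (intro mult_right_mono) auto
  finally show ?thesis by (simp only: set_integral_mult_right mult_1)
qed

text \<open>Let \<open>M\<close> be the sum of \<open>C\<close> and the two sup-norms, and \<open>Z = M\<^sup>2 / k ^ 4\<close>. Each boundary layer contributes an error of at most
  \<open>2 * ln k * Z + Z / 2\<close> and the interior at most \<open>7 / 12 * Z\<close>; as \<open>ln k \<ge> 1\<close>, the sum is below
  \<open>6 * ln k * Z\<close>.\<close>

lemma full_integral:
  assumes k: "27 \<le> k"
  shows "\<bar>(LINT x:{0..<1}|lborel. bias_inf (purf k) s x)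
        - ((s' 0)\<^sup>2 + (Lim (at_left 1) s')\<^sup>2) / (8 * real k ^ 3)\<bar>
      \<le> 6 * (C + sup_norm01 s' + sup_norm01 s'')\<^sup>2 * ln (real k) / real k ^ 4"
proof -
  define n P Q M L \<epsilon> where "n = real k" and "P = sup_norm01 s'" and "Q = sup_norm01 s''" and "M = C + P + Q"
    and "L = Lim (at_left 1) s'" and "\<epsilon> = 4 * ln (real k) / real k"
  let ?b = "bias_inf (purf k) s"
  have n: "27 \<le> n" "0 < n" using k by (auto simp: n_def)
  have PQ: "0 \<le> P" "0 \<le> Q" using abs_le_sup_norm01[of 0] by (auto simp: P_def Q_def)
  have PQM: "P + Q \<le> M" "P \<le> M" "Q \<le> M" "0 \<le> M" using C_pos PQ by (auto simp: M_def)
  have e: "0 < \<epsilon>" "\<epsilon> \<le> 1 / 2" using k boundary_layer_width[OF k] by (auto simp: \<epsilon>_def)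
  have tail: "(1 - \<epsilon>) ^ (2 * k + 3) \<le> 1 / real k ^ 4"
    using k e by (intro power_tail_le) (auto simp: \<epsilon>_def)
  have point: "\<bar>?b x - (s' x)\<^sup>2 * (x ^ (k + 1) - (1 - x) ^ (k + 1))\<^sup>2 / (4 * (real k)\<^sup>2)\<bar> \<le> M\<^sup>2 / (2 * real k ^ 3)"
    if "x \<in> {0<..<1}" for x
  proof -
    have "(C + \<bar>s' x\<bar> + \<bar>s'' x\<bar>)\<^sup>2 / (2 * real k ^ 3) \<le> M\<^sup>2 / (2 * real k ^ 3)"
      using abs_le_sup_norm01[of x] that C_pos unfolding M_def P_def Q_def
      by (intro divide_right_mono power_mono add_mono) auto
    with boundary_bias[OF k, of x] that show ?thesis by simp
  qed
  have left: "\<bar>(LINT x:{0<..<\<epsilon>}|lborel. ?b x) - (s' 0)\<^sup>2 / (8 * real k ^ 3)\<bar> \<le> \<epsilon> * M\<^sup>2 / (2 * real k ^ 3) + 1 / 2 * (M\<^sup>2 / real k ^ 4)"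
  proof (rule boundary_integral[OF k e(1) _ tail])
    show "set_integrable lborel {0<..<\<epsilon>} ?b" using e by (intro set_integrable_bias_inf k) auto
    show "(s' 0)\<^sup>2 \<le> M\<^sup>2" using abs_le_sup_norm01(1)[of 0] PQM
      by (intro power2_le_iff_abs_le[THEN iffD2]) (auto simp: P_def)
    fix x assume x: "x \<in> {0<..<\<epsilon>}"
    have "\<bar>(s' x)\<^sup>2 * (x ^ (k + 1) - (1 - x) ^ (k + 1))\<^sup>2 / (4 * (real k)\<^sup>2) - (s' 0)\<^sup>2 * (1 - x) ^ (2 * k + 2) / (4 * (real k)\<^sup>2)\<bar>
      \<le> 5 / 8 * (M\<^sup>2 / (real k)\<^sup>2) * (x * (1 - x) ^ (2 * k + 1))"
      using x e k PQ PQM abs_le_sup_norm01(1)[of 0] abs_le_sup_norm01(1)[of x] s'_Lipschitz[of x 0]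
      by (intro boundary_weight[where P=P and Q=Q]) (auto simp: P_def Q_def)
    with point[of x] x e show "\<bar>?b x - (s' 0)\<^sup>2 * (1 - x) ^ (2 * k + 2) / (4 * (real k)\<^sup>2)\<bar>
      \<le> M\<^sup>2 / (2 * real k ^ 3) + 5 / 8 * (M\<^sup>2 / (real k)\<^sup>2) * (x * (1 - x) ^ (2 * k + 1))"
      by auto
  qed (use e in auto)
  have ir: "set_integrable lborel {1 - \<epsilon><..<1} ?b" using e by (intro set_integrable_bias_inf k) auto
  have reflect: "indicator {1 - \<epsilon><..<1} (1 + - 1 * x) *\<^sub>R ?b (1 + - 1 * x) = indicator {0<..<\<epsilon>} x *\<^sub>R ?b (1 - x)" for x
    by (auto split: split_indicator)
  have right: "\<bar>(LINT x:{0<..<\<epsilon>}|lborel. ?b (1 - x)) - L\<^sup>2 / (8 * real k ^ 3)\<bar> \<le> \<epsilon> * M\<^sup>2 / (2 * real k ^ 3) + 1 / 2 * (M\<^sup>2 / real k ^ 4)"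
  proof (rule boundary_integral[OF k e(1) _ tail])
    show "set_integrable lborel {0<..<\<epsilon>} (\<lambda>x. ?b (1 - x))"
      using lborel_integrable_real_affine[OF ir[unfolded set_integrable_def], of "- 1" 1]
      unfolding set_integrable_def reflect by simp
    show "L\<^sup>2 \<le> M\<^sup>2" using s'_at_left_1(1) PQM
      by (intro power2_le_iff_abs_le[THEN iffD2]) (auto simp: P_def L_def)
    fix x assume x: "x \<in> {0<..<\<epsilon>}"
    have mem: "1 - x \<in> {0<..<1}" and inv: "1 - (1 - x) = x" using x e by auto
    have "\<bar>?b (1 - x) - (s' (1 - x))\<^sup>2 * (x ^ (k + 1) - (1 - x) ^ (k + 1))\<^sup>2 / (4 * (real k)\<^sup>2)\<bar> \<le> M\<^sup>2 / (2 * real k ^ 3)"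
      unfolding power2_commute[of "x ^ (k + 1)" "(1 - x) ^ (k + 1)"] by (rule point[OF mem, unfolded inv])
    moreover have "\<bar>(s' (1 - x))\<^sup>2 * (x ^ (k + 1) - (1 - x) ^ (k + 1))\<^sup>2 / (4 * (real k)\<^sup>2) - L\<^sup>2 * (1 - x) ^ (2 * k + 2) / (4 * (real k)\<^sup>2)\<bar>
      \<le> 5 / 8 * (M\<^sup>2 / (real k)\<^sup>2) * (x * (1 - x) ^ (2 * k + 1))"
      using x e k PQ PQM abs_le_sup_norm01(1)[of "1 - x"] s'_at_left_1(1) s'_at_left_1(2)[of "1 - x"]
      by (intro boundary_weight[where P=P and Q=Q]) (auto simp: P_def Q_def L_def)
    ultimately show "\<bar>?b (1 - x) - L\<^sup>2 * (1 - x) ^ (2 * k + 2) / (4 * (real k)\<^sup>2)\<bar>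
      \<le> M\<^sup>2 / (2 * real k ^ 3) + 5 / 8 * (M\<^sup>2 / (real k)\<^sup>2) * (x * (1 - x) ^ (2 * k + 1))"
      by linarith
  qed (use e in auto)
  have reflected: "(LINT x:{1 - \<epsilon><..<1}|lborel. ?b x) = (LINT x:{0<..<\<epsilon>}|lborel. ?b (1 - x))"
    unfolding set_lebesgue_integral_def
    by (subst lborel_integral_real_affine[of "- 1" _ 1]) (simp_all only: reflect, simp_all)
  have mid: "0 \<le> (LINT x:{\<epsilon>..1 - \<epsilon>}|lborel. ?b x)" "(LINT x:{\<epsilon>..1 - \<epsilon>}|lborel. ?b x) \<le> 7 / 12 * (M\<^sup>2 / n ^ 4)"
  proof -
    show "0 \<le> (LINT x:{\<epsilon>..1 - \<epsilon>}|lborel. ?b x)" unfolding set_lebesgue_integral_def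
      by (intro Bochner_Integration.integral_nonneg) (simp add: bias_inf_def)
    have b: "?b x \<le> 7 / 12 * (M\<^sup>2 / n ^ 4)" if x: "x \<in> {\<epsilon>..1 - \<epsilon>}" for x
    proof -
      have s: "\<bar>s' x\<bar> \<le> P" "\<bar>s'' x\<bar> \<le> Q" using abs_le_sup_norm01[of x] x e by (auto simp: P_def Q_def)
      have "(3 * C + 1 / 27\<^sup>2 * \<bar>s' x\<bar> + 2 * \<bar>s'' x\<bar>)\<^sup>2 \<le> (3 * M)\<^sup>2"
        using s C_pos PQ unfolding M_def by (intro power_mono) auto
      then have "(3 * C + 1 / 27\<^sup>2 * \<bar>s' x\<bar> + 2 * \<bar>s'' x\<bar>)\<^sup>2 / n ^ 5 \<le> (3 * M)\<^sup>2 / (27 * n ^ 4)"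
        using n by (intro frac_le) (auto simp: power_numeral_reduce)
      also have "\<dots> = 1 / 3 * (M\<^sup>2 / n ^ 4)" by (simp add: power_mult_distrib)
      finally have 1: "(3 * C + 1 / 27\<^sup>2 * \<bar>s' x\<bar> + 2 * \<bar>s'' x\<bar>)\<^sup>2 / n ^ 5 \<le> 1 / 3 * (M\<^sup>2 / n ^ 4)" .
      have "(s'' x)\<^sup>2 \<le> M\<^sup>2" using s PQM by (intro power2_le_iff_abs_le[THEN iffD2]) auto
      then have "(s'' x)\<^sup>2 / (4 * n ^ 4) \<le> M\<^sup>2 / (4 * n ^ 4)" using n by (intro divide_right_mono) auto
      moreover have "M\<^sup>2 / (4 * n ^ 4) = 1 / 4 * (M\<^sup>2 / n ^ 4)" by simp
      ultimately show ?thesis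
        using interior_bias[OF k x[unfolded \<epsilon>_def]] 1 unfolding n_def[symmetric] by linarith
    qed
    have "(LINT x:{\<epsilon>..1 - \<epsilon>}|lborel. ?b x) \<le> (LINT x:{\<epsilon>..1 - \<epsilon>}|lborel. 7 / 12 * (M\<^sup>2 / n ^ 4))"
      using b e by (intro set_integral_mono set_integrable_bias_inf k borel_integrable_atLeastAtMost' continuous_intros) auto
    also have "\<dots> = (1 - 2 * \<epsilon>) * (7 / 12 * (M\<^sup>2 / n ^ 4))" using e by (simp add: set_lebesgue_integral_def)
    also have "\<dots> \<le> 1 * (7 / 12 * (M\<^sup>2 / n ^ 4))" using e n by (intro mult_right_mono) auto
    finally show "(LINT x:{\<epsilon>..1 - \<epsilon>}|lborel. ?b x) \<le> 7 / 12 * (M\<^sup>2 / n ^ 4)" by simp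
  qed
  have split: "(LINT x:{0..<1}|lborel. ?b x) =
      (LINT x:{0<..<\<epsilon>}|lborel. ?b x) + (LINT x:{\<epsilon>..1 - \<epsilon>}|lborel. ?b x) + (LINT x:{1 - \<epsilon><..<1}|lborel. ?b x)"
  proof -
    have "(LINT x:{0..<1}|lborel. ?b x) = (LINT x:{0<..<1}|lborel. ?b x)"
      by (intro set_integral_Ioo_eq_Ico(2) set_integrable_bias_inf k) auto
    also have "{0<..<1} = ({0<..<\<epsilon>} \<union> {\<epsilon>..1 - \<epsilon>}) \<union> {1 - \<epsilon><..<1}" using e by auto
    also have "(LINT x:\<dots>|lborel. ?b x) = (LINT x:{0<..<\<epsilon>} \<union> {\<epsilon>..1 - \<epsilon>}|lborel. ?b x) + (LINT x:{1 - \<epsilon><..<1}|lborel. ?b x)"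
      using e by (intro set_integral_Un set_integrable_bias_inf k) auto
    also have "(LINT x:{0<..<\<epsilon>} \<union> {\<epsilon>..1 - \<epsilon>}|lborel. ?b x) = (LINT x:{0<..<\<epsilon>}|lborel. ?b x) + (LINT x:{\<epsilon>..1 - \<epsilon>}|lborel. ?b x)"
      using e by (intro set_integral_Un set_integrable_bias_inf k) auto
    finally show ?thesis .
  qed
  define Z where "Z = M\<^sup>2 / n ^ 4"
  have Z: "0 \<le> Z" using n by (simp add: Z_def)
  have ln1: "1 \<le> ln n"
  proof -
    have "exp 1 \<le> n" using exp_le n by linarith
    then show ?thesis using n by (subst ln_ge_iff) auto
  qed
  have eM: "\<epsilon> * M\<^sup>2 / (2 * n ^ 3) = 2 * (ln n * Z)"
    unfolding \<epsilon>_def Z_def n_def[symmetric] by (simp add: power_numeral_reduce)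
  have "Z \<le> ln n * Z" using mult_right_mono[OF ln1 Z] by simp
  moreover have "((s' 0)\<^sup>2 + L\<^sup>2) / (8 * real k ^ 3) = (s' 0)\<^sup>2 / (8 * real k ^ 3) + L\<^sup>2 / (8 * real k ^ 3)"
    by (simp add: add_divide_distrib)
  ultimately have "\<bar>(LINT x:{0..<1}|lborel. ?b x) - ((s' 0)\<^sup>2 + L\<^sup>2) / (8 * real k ^ 3)\<bar> \<le> 6 * (ln n * Z)"
    using left right mid Z unfolding split reflected n_def[symmetric] Z_def[symmetric] eM by linarith
  then show ?thesis by (simp add: L_def Z_def M_def P_def Q_def n_def mult_ac)
qed

end

theorem corollary8:
  fixes k :: nat and \<epsilon> C\<^sub>3 :: real and s s' s'' :: "real \<Rightarrow> real"
  assumes "k \<ge> 27"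
    and "\<epsilon> = 4 * ln (real k) / real k"
    and "\<forall>x\<in>{0..<1}. (s has_real_derivative s' x) (at x within {0..<1})"
    and "\<forall>x\<in>{0..<1}. (s' has_real_derivative s'' x) (at x within {0..<1})"
    and "C\<^sub>3 > 0"
    and "\<forall>t\<in>{0..<1}. \<forall>x\<in>{0..<1}.
      \<bar>s t - s x - s' x * (t - x) - 1 / 2 * s'' x * (t - x)\<^sup>2\<bar> \<le> C\<^sub>3 * \<bar>t - x\<bar> ^ 3"
  shows "(\<forall>x\<in>{\<epsilon>..1 - \<epsilon>}.
        \<bar>bias_inf (purf k) s x - (s'' x)\<^sup>2 / (4 * real k ^ 4)\<bar>
          \<le> (3 * C\<^sub>3 + 1 / 27\<^sup>2 * \<bar>s' x\<bar> + 2 * \<bar>s'' x\<bar>)\<^sup>2 / real k ^ 5) \<and>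
    (\<forall>x\<in>{0<..<1} - {\<epsilon>..1 - \<epsilon>}.
        \<bar>bias_inf (purf k) s x - (s' x)\<^sup>2 * (x ^ (k + 1) - (1 - x) ^ (k + 1))\<^sup>2 / (4 * (real k)\<^sup>2)\<bar>
          \<le> (C\<^sub>3 + \<bar>s' x\<bar> + \<bar>s'' x\<bar>)\<^sup>2 / (2 * real k ^ 3)) \<and>
    \<bar>(LINT x:{0..<1}|lborel. bias_inf (purf k) s x)
        - ((s' 0)\<^sup>2 + (Lim (at_left 1) s')\<^sup>2) / (8 * real k ^ 3)\<bar>
      \<le> 6 * (C\<^sub>3 + sup_norm01 s' + sup_norm01 s'')\<^sup>2 * ln (real k) / real k ^ 4 \<and>
    \<bar>(LINT x:{\<epsilon>..1 - \<epsilon>}|lborel. bias_inf (purf k) s x)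
        - 1 / (4 * real k ^ 4) * (LINT x:{\<epsilon>..1 - \<epsilon>}|lborel. (s'' x)\<^sup>2)\<bar>
      \<le> (3 * C\<^sub>3 + 1 / 27\<^sup>2 * sup_norm01 s' + 2 * sup_norm01 s'')\<^sup>2 / real k ^ 5"
proof -
  interpret taylor_bounded s s' s'' C\<^sub>3
    using assms(3-6) by unfold_locales auto
  note k = assms(1) and \<epsilon> = assms(2)
  have "0 < x" "x < 1" if "x \<in> {0<..<1} - {\<epsilon>..1 - \<epsilon>}" for x using that by simp_all
  then show ?thesis
    by (intro conjI ballI interior_bias[OF k, folded \<epsilon>] boundary_bias[OF k] full_integral[OF k]
        interior_integral[OF k \<epsilon>])
qed

end
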